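(* Let $\mathcal{H}$ be a complex Hilbert space, let $A \in \mathcal{B}(\mathcal{H})$, and suppose that $W(A) \subseteq \overline{D}$, where $D \subseteq \mathbb{C}$ is a convex set. Let $\Gamma$ be a compact regular analytic curve contained in $\partial D$ such that none of the tangent lines to $\Gamma$ intersect $W_{\mathrm{ess}}(A)$ and $\Gamma$ is not a line segment. If $\overline{W(A)}$ intersects $\Gamma$ at infinitely many points, then $\Gamma \subset W(A)$.
   Context: $\mathcal{B}(\mathcal{H})$ denotes the set of bounded linear operators on the complex Hilbert space $\mathcal{H}$ (finite or infinite dimensional), and $S_{\mathcal{H}}$ denotes the unit sphere of $\mathcal{H}$. The numerical range of $A \in \mathcal{B}(\mathcal{H})$ is $W(A) := \{\langle Ax, x\rangle : x \in S_{\mathcal{H}}\} \subseteq \mathbb{C}$. The essential numerical range of $A$ is $W_{\mathrm{ess}}(A) := \bigcap_{K} \overline{W(A+K)}$, where the intersection is taken over all compact operators $K \in \mathcal{B}(\mathcal{H})$; in particular $W_{\mathrm{ess}}(A) = \varnothing$ when $\mathcal{H}$ is finite dimensional. Overlines denote closures in $\mathbb{C}$, and $\partial D$ is the boundary of $D$ in $\mathbb{C}$. A curve is analytic if it is the range of an analytic function $\gamma$ from an interval $I \subseteq \mathbb{R}$ into $\mathbb{C}$; it is regular if $\gamma'(t) \neq 0$ for all $t \in I$.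
   Formalization: "Compact curve" is taken to mean that the parameter interval I is a compact interval [a,b] with a < b; if only the range had to be compact, a half-open interval such as [0,2π) would be allowed and the claim would fail. *)

theory Defs
  imports "HOL-Analysis.Analysis"
begin

text \<open>
  Complex Hilbert spaces. The inner product is linear in its first argument, so that
  \<open>numerical_range (\<lambda>x. c *\<^sub>C x)\<close> is \<open>{c}\<close> in a nonzero space. The axiom \<open>cinner_self\<close> says
  that the norm is the one induced by the inner product; positive definiteness of the latter
  follows from it and the norm axioms.
\<close>

class complex_inner = real_normed_vector +
  fixes scaleC :: "complex \<Rightarrow> 'a \<Rightarrow> 'a"  (infixr "*\<^sub>C" 75)
    and cinner :: "'a \<Rightarrow> 'a \<Rightarrow> complex"
  assumes scaleC_add_right: "c *\<^sub>C (x + y) = c *\<^sub>C x + c *\<^sub>C y"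
    and scaleC_add_left: "(c + d) *\<^sub>C x = c *\<^sub>C x + d *\<^sub>C x"
    and scaleC_scaleC: "c *\<^sub>C d *\<^sub>C x = (c * d) *\<^sub>C x"
    and scaleR_scaleC: "r *\<^sub>R x = complex_of_real r *\<^sub>C x"
    and cinner_commute: "cinner x y = cnj (cinner y x)"
    and cinner_add_left: "cinner (x + y) z = cinner x z + cinner y z"
    and cinner_scaleC_left: "cinner (c *\<^sub>C x) y = c * cinner x y"
    and cinner_self: "cinner x x = complex_of_real ((norm x)\<^sup>2)"

class chilbert_space = complex_inner + complete_space

instantiation complex :: chilbert_space
begin

definition scaleC_complex :: "complex \<Rightarrow> complex \<Rightarrow> complex"
  where "scaleC_complex c x = c * x"

definition cinner_complex :: "complex \<Rightarrow> complex \<Rightarrow> complex"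
  where "cinner_complex x y = x * cnj y"

instance
  by standard
    (simp_all add: scaleC_complex_def cinner_complex_def algebra_simps scaleR_conv_of_real
      complex_norm_square[symmetric])

end

definition bounded_clinear :: "('a::complex_inner \<Rightarrow> 'b::complex_inner) \<Rightarrow> bool"
  where "bounded_clinear A \<longleftrightarrow> bounded_linear A \<and> (\<forall>c x. A (c *\<^sub>C x) = c *\<^sub>C A x)"

definition compact_clinear :: "('a::complex_inner \<Rightarrow> 'b::complex_inner) \<Rightarrow> bool"
  where "compact_clinear K \<longleftrightarrow> bounded_clinear K \<and> compact (closure (K ` cball 0 1))"

definition numerical_range :: "('a::complex_inner \<Rightarrow> 'a) \<Rightarrow> complex set"
  where "numerical_range A = {cinner (A x) x | x. norm x = 1}"

definition essential_numerical_range :: "('a::complex_inner \<Rightarrow> 'a) \<Rightarrow> complex set"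
  where "essential_numerical_range A =
    (\<Inter>K\<in>{K. compact_clinear K}. closure (numerical_range (\<lambda>x. A x + K x)))"

text \<open>
  Real analyticity relative to \<open>S\<close>. At an endpoint of an interval the expansion is only required
  to represent \<open>f\<close> on the side lying in the interval.
\<close>

definition real_analytic_on :: "(real \<Rightarrow> 'b::real_normed_vector) \<Rightarrow> real set \<Rightarrow> bool"
  where "real_analytic_on f S \<longleftrightarrow>
    (\<forall>t0\<in>S. \<exists>e>0. \<exists>c. \<forall>t\<in>S. \<bar>t - t0\<bar> < e \<longrightarrow> (\<lambda>n. (t - t0) ^ n *\<^sub>R c n) sums f t)"

text \<open>
  A compact curve is parametrised by a compact interval (compactness of the image alone would admit
  closed curves parametrised by a half-open interval, with no control of the parametrisation at
  the missing endpoint). Derivatives at the endpoints are one-sided.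
\<close>

definition compact_regular_analytic_curve :: "(real \<Rightarrow> complex) \<Rightarrow> real \<Rightarrow> real \<Rightarrow> bool"
  where "compact_regular_analytic_curve \<gamma> a b \<longleftrightarrow>
    a < b \<and> real_analytic_on \<gamma> {a..b} \<and>
    (\<forall>t\<in>{a..b}. vector_derivative \<gamma> (at t within {a..b}) \<noteq> 0)"

definition tangent_line :: "(real \<Rightarrow> complex) \<Rightarrow> real set \<Rightarrow> real \<Rightarrow> complex set"
  where "tangent_line \<gamma> I t = {\<gamma> t + s *\<^sub>R vector_derivative \<gamma> (at t within I) | s. True}"

end

(*
  The tangent line at a point g = \<gamma> t supports D, so the self-adjoint operator
  P(t) = Im (cnj (\<gamma>' t) (A - \<gamma> t)) is semidefinite, and its quadratic form vanishes at a unit vector x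
  exactly when <A x, x> lies on the tangent line. Since this line misses the essential numerical range,
  P(t) is bounded below on the orthogonal complement of a finite-dimensional space F. This has two
  consequences. By compactness, \<gamma> t lies in W(A) as soon as it lies in the closure. And adding the
  projection onto F makes P coercive, with an inverse that extends holomorphically to complex t, so
  that near each parameter P(t) has a kernel iff a holomorphic determinant vanishes. An accumulation
  of contact parameters thus forces a kernel at all nearby t. As the curve is not a segment, the
  tangent line at an interior parameter meets the closure of D only at \<gamma> t, which is therefore
  attained. The set of contact parameters is closed, and connectedness of the interval concludes.
*)
theory Submission
  imports Defs "HOL-Complex_Analysis.Complex_Analysis" "Jordan_Normal_Form.Determinant"
begin


subsection \<open>Complex inner product spaces\<close>

text \<open>The direction of the parametrisation does not tell on which side of the tangent
  \<open>D\<close> lies, so each tangent operator is semidefinite only up to a nonzero real factor.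
  The factor fixed at the accumulation point is kept along the whole holomorphic family; this is
  harmless because kernels do not see it. The operator involves both the curve and its conjugate,
  and conjugation is not holomorphic. The two are therefore continued by separate power series, and
  off the real axis the continued operators need not be self-adjoint. What survives nearby is a
  positive lower bound for the real part of the form, so invertibility comes from the Lax-Milgram
  argument. Continuation of kernels gives contact at interior parameters. At an endpoint the tangent
  may contain further points of \<open>closure D\<close>, as when an arc runs smoothly into a
  segment of the boundary; there contact is recovered as a limit of interior contacts.\<close>

lemma cinner_add_right: "cinner x (y + z) = cinner x y + cinner x z"
  by (metis cinner_commute cinner_add_left complex_cnj_add)

lemma cinner_scaleC_right: "cinner x (c *\<^sub>C y) = cnj c * cinner x y"
  by (metis cinner_commute cinner_scaleC_left complex_cnj_mult)

lemma norm_scaleC: "norm (c *\<^sub>C x) = norm c * norm x"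
proof -
  have "complex_of_real ((norm (c *\<^sub>C x))\<^sup>2) = complex_of_real ((norm c * norm x)\<^sup>2)"
    unfolding cinner_self[symmetric] cinner_scaleC_left cinner_scaleC_right power_mult_distrib
    by (simp only: of_real_mult complex_norm_square cinner_self[symmetric] mult_ac)
  then show ?thesis
    by (simp add: power2_eq_iff_nonneg del: of_real_power)
qed

lemma norm_add_sq: "(norm (x + y))\<^sup>2 = (norm x)\<^sup>2 + (norm y)\<^sup>2 + 2 * Re (cinner x y)"
  for x y :: "'a::complex_inner"
proof -
  have "complex_of_real ((norm (x + y))\<^sup>2) =
      of_real ((norm x)\<^sup>2) + of_real ((norm y)\<^sup>2) + (cinner x y + cnj (cinner x y))"
    unfolding cinner_self[symmetric] cinner_commute[of y x, symmetric]
    by (simp add: cinner_add_left cinner_add_right)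
  then have "Re (complex_of_real ((norm (x + y))\<^sup>2)) =
      Re (of_real ((norm x)\<^sup>2) + of_real ((norm y)\<^sup>2) + (cinner x y + cnj (cinner x y)))"
    by (rule arg_cong)
  then show ?thesis
    by (simp del: of_real_power)
qed

lemma scaleC_minus_one: "(- 1) *\<^sub>C x = - x"
  using scaleR_scaleC[of "-1" x] by simp

lemma cinner_minus_left: "cinner (- x) y = - cinner x y"
  using cinner_scaleC_left[of "-1" x y] by (simp add: scaleC_minus_one)

lemma cinner_minus_right: "cinner x (- y) = - cinner x y"
  using cinner_scaleC_right[of x "-1" y] by (simp add: scaleC_minus_one)

lemma cinner_eq_zero_self: "cinner x x = 0 \<longleftrightarrow> x = 0"
  by (simp add: cinner_self)

lemma cinner_Cauchy_Schwarz: "norm (cinner x y) \<le> norm x * norm y"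
proof (cases "y = 0")
  case True
  have "cinner x (0 *\<^sub>R y) = 0"
    unfolding scaleR_scaleC by (simp add: cinner_scaleC_right)
  then show ?thesis
    using True by simp
next
  case False
  define w where "w = cinner x y"
  \<comment> \<open>This \<open>c\<close> makes \<open>x + c *\<^sub>C y\<close> orthogonal to
    \<open>y\<close>, so its norm is the distance from \<open>x\<close> to the line spanned by
    \<open>y\<close>.\<close>
  define c where "c = - w / of_real ((norm y)\<^sup>2)"
  have "0 \<le> (norm (x + c *\<^sub>C y))\<^sup>2"
    by simp
  also have "\<dots> = (norm x)\<^sup>2 + (norm c * norm y)\<^sup>2 + 2 * Re (cnj c * w)"
    by (simp add: norm_add_sq norm_scaleC cinner_scaleC_right w_def)
  also have "cnj c * w = - of_real ((norm w)\<^sup>2 / (norm y)\<^sup>2)"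
    unfolding c_def by (simp add: complex_norm_square[of w, unfolded of_real_power] mult.commute)
  also have "(norm c * norm y)\<^sup>2 = (norm w)\<^sup>2 / (norm y)\<^sup>2"
    using False unfolding c_def by (simp add: norm_divide norm_mult power2_eq_square)
  finally have "(norm w)\<^sup>2 / (norm y)\<^sup>2 \<le> (norm x)\<^sup>2"
    by (simp del: of_real_power)
  then have "(norm w)\<^sup>2 \<le> (norm x * norm y)\<^sup>2"
    using False by (simp add: divide_le_eq power_mult_distrib)
  then show ?thesis
    unfolding w_def by (rule power2_le_imp_le) simp
qed

lemma bounded_bilinear_cinner: "bounded_bilinear cinner"
proof
  show "cinner (r *\<^sub>R x) y = r *\<^sub>R cinner x y" "cinner x (r *\<^sub>R y) = r *\<^sub>R cinner x y" for r and x y :: 'a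
    by (simp_all add: scaleR_scaleC[where 'a = 'a] cinner_scaleC_left cinner_scaleC_right scaleR_conv_of_real)
  show "\<exists>K. \<forall>(x::'a) y. norm (cinner x y) \<le> norm x * norm y * K"
    using cinner_Cauchy_Schwarz by (intro exI[of _ 1]) auto
qed (simp_all add: cinner_add_left cinner_add_right)

lemma bounded_bilinear_scaleC: "bounded_bilinear (*\<^sub>C)"
proof
  show "(r *\<^sub>R c) *\<^sub>C x = r *\<^sub>R (c *\<^sub>C x)" "c *\<^sub>C (r *\<^sub>R x) = r *\<^sub>R (c *\<^sub>C x)" for r c and x :: 'a
    by (simp_all add: scaleR_scaleC[where 'a = 'a] scaleC_scaleC scaleR_conv_of_real mult.commute)
  show "\<exists>K. \<forall>c (x::'a). norm (c *\<^sub>C x) \<le> norm c * norm x * K"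
    by (intro exI[of _ 1]) (simp add: norm_scaleC)
qed (simp_all add: scaleC_add_left scaleC_add_right)

lemmas cinner_diff_left = bounded_bilinear.diff_left[OF bounded_bilinear_cinner]
  and cinner_diff_right = bounded_bilinear.diff_right[OF bounded_bilinear_cinner]
  and cinner_zero_left = bounded_bilinear.zero_left[OF bounded_bilinear_cinner]
  and cinner_zero_right = bounded_bilinear.zero_right[OF bounded_bilinear_cinner]
  and cinner_sum_left = bounded_bilinear.sum_left[OF bounded_bilinear_cinner]
  and cinner_sum_right = bounded_bilinear.sum_right[OF bounded_bilinear_cinner]
  and tendsto_cinner = bounded_bilinear.tendsto[OF bounded_bilinear_cinner]
  and scaleC_diff_left = bounded_bilinear.diff_left[OF bounded_bilinear_scaleC]
  and scaleC_zero_left = bounded_bilinear.zero_left[OF bounded_bilinear_scaleC]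
  and scaleC_zero_right = bounded_bilinear.zero_right[OF bounded_bilinear_scaleC]
  and scaleC_sum_right = bounded_bilinear.sum_right[OF bounded_bilinear_scaleC]
  and tendsto_scaleC = bounded_bilinear.tendsto[OF bounded_bilinear_scaleC]

lemma scaleC_one: "1 *\<^sub>C x = x"
  using scaleR_scaleC[of 1 x] by simp

lemma norm_diff_sq: "(norm (x - y))\<^sup>2 = (norm x)\<^sup>2 + (norm y)\<^sup>2 - 2 * Re (cinner x y)"
  for x y :: "'a::complex_inner"
  using norm_add_sq[of x "- y"] by (simp add: cinner_minus_right)

lemma parallelogram: "(norm (x + y))\<^sup>2 + (norm (x - y))\<^sup>2 = 2 * (norm x)\<^sup>2 + 2 * (norm y)\<^sup>2"
  for x y :: "'a::complex_inner"
  by (simp add: norm_add_sq norm_diff_sq)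

lemma cinner_left_eqI: "(\<And>z. cinner x z = cinner y z) \<Longrightarrow> x = y"
  by (metis cinner_diff_left cinner_eq_zero_self eq_iff_diff_eq_0)

lemma bounded_clinear_bounded_linear: "bounded_clinear A \<Longrightarrow> bounded_linear A"
  by (simp add: bounded_clinear_def)

lemma bounded_clinear_scaleC: "bounded_clinear A \<Longrightarrow> A (c *\<^sub>C x) = c *\<^sub>C A x"
  by (simp add: bounded_clinear_def)

lemma bounded_clinear_add: "bounded_clinear A \<Longrightarrow> A (x + y) = A x + A y"
  by (simp add: bounded_clinear_def linear_add bounded_linear.linear)

lemma bounded_clinear_diff: "bounded_clinear A \<Longrightarrow> A (x - y) = A x - A y"
  by (simp add: bounded_clinear_def linear_diff bounded_linear.linear)

lemma bounded_clinearI: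
  assumes "\<And>x y. A (x + y) = A x + A y" and "\<And>c x. A (c *\<^sub>C x) = c *\<^sub>C A x"
    and "\<And>x. norm (A x) \<le> norm x * K"
  shows "bounded_clinear A"
  unfolding bounded_clinear_def
proof
  show "bounded_linear A"
    by (rule bounded_linear_intro[of _ K]) (simp_all add: assms scaleR_scaleC)
qed (simp add: assms)

text \<open>This is the first-order condition at a minimum, \<open>s\<close> being the size of a
  variation. It serves the minimiser in the Riesz theorem and the zeros of a semidefinite
  form.\<close>

lemma linear_term_zero:
  fixes a b :: real
  assumes "\<And>s. 0 \<le> s\<^sup>2 * b + s * a"
  shows "a = 0"
proof (rule ccontr)
  assume "a \<noteq> 0"
  \<comment> \<open>At \<open>s = - a / B\<close> the upper bound is
    \<open>a\<^sup>2 * (B - 1) / B\<^sup>2 - a\<^sup>2 / B\<close>. The excess of \<open>B\<close>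
    over the absolute value of \<open>b\<close> makes it strictly negative, and \<open>B\<close>
    stays nonzero when \<open>b = 0\<close>.\<close>
  define B where "B = 1 + \<bar>b\<bar>"
  have "0 < B" "\<bar>b\<bar> = B - 1"
    unfolding B_def by auto
  define s where "s = - a / B"
  have "s\<^sup>2 * b + s * a \<le> s\<^sup>2 * \<bar>b\<bar> + s * a"
    by (simp add: mult_left_mono)
  also have "\<dots> = - a\<^sup>2 / B\<^sup>2"
    unfolding s_def \<open>\<bar>b\<bar> = B - 1\<close> using \<open>0 < B\<close> by (simp add: field_simps power2_eq_square)
  also have "\<dots> < 0"
    using \<open>a \<noteq> 0\<close> \<open>0 < B\<close> by simp
  finally show False
    using assms[of s] by simp
qed

text \<open>The representing vector minimises \<open>\<lambda>x. (norm x)\<^sup>2 - 2 * Re (f x)\<close>; minimising sequences are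
  Cauchy by the parallelogram law.\<close>

lemma Riesz_representation:
  fixes f :: "'a::chilbert_space \<Rightarrow> complex"
  assumes f: "bounded_clinear f"
  obtains y where "\<And>x. f x = cinner x y"
proof -
  have lin: "bounded_linear f"
    using f by (rule bounded_clinear_bounded_linear)
  define \<phi> where "\<phi> x = (norm x)\<^sup>2 - 2 * Re (f x)" for x
  obtain K where K: "\<And>x. norm (f x) \<le> norm x * K"
    using bounded_linear.bounded[OF lin] by blast
  \<comment> \<open>Completing the square: the bound is attained formally at
    \<open>norm x = K\<close>.\<close>
  have below: "- K\<^sup>2 \<le> \<phi> x" for x
  proof -
    have "Re (f x) \<le> norm x * K"
      using K[of x] complex_Re_le_cmod[of "f x"] by linarith
    moreover have "0 \<le> (norm x - K)\<^sup>2"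
      by simp
    ultimately show ?thesis
      unfolding \<phi>_def by (simp add: power2_diff)
  qed
  define m where "m = (INF x. \<phi> x)"
  have bdd: "bdd_below (range \<phi>)"
    using below by (auto simp: bdd_below_def)
  have m_le: "m \<le> \<phi> x" for x
    unfolding m_def by (rule cINF_lower[OF bdd]) simp
  have "\<exists>x. \<phi> x < m + inverse (of_nat (Suc n))" for n
  proof -
    have "(INF x. \<phi> x) < m + inverse (of_nat (Suc n))"
      unfolding m_def by simp
    then show ?thesis
      using cINF_less_iff[OF _ bdd] by auto
  qed
  then obtain x where x: "\<And>n. \<phi> (x n) < m + inverse (of_nat (Suc n))"
    by metis
  \<comment> \<open>The comparison is made at the midpoint of \<open>u\<close> and \<open>v\<close>,
    where \<phi> is still at least \<open>m\<close>.\<close>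
  have gap: "(norm (u - v))\<^sup>2 \<le> 2 * (\<phi> u - m) + 2 * (\<phi> v - m)" for u v
  proof -
    have "(norm (u + v))\<^sup>2 = 4 * (norm ((1/2) *\<^sub>R (u + v)))\<^sup>2"
      by (simp add: power2_eq_square)
    moreover have "f ((1/2) *\<^sub>R (u + v)) = (1/2) *\<^sub>R (f u + f v)"
      by (simp add: linear_simps[OF lin])
    ultimately have "(norm (u + v))\<^sup>2 = 4 * \<phi> ((1/2) *\<^sub>R (u + v)) + 4 * Re (f u) + 4 * Re (f v)"
      unfolding \<phi>_def by simp
    then show ?thesis
      using parallelogram[of u v] m_le[of "(1/2) *\<^sub>R (u + v)"] unfolding \<phi>_def by simp
  qed
  have "Cauchy x"
  proof (rule metric_CauchyI)
    fix e :: real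
    assume "0 < e"
    then obtain N where "inverse (real (Suc N)) < e\<^sup>2 / 4"
      using reals_Archimedean[of "e\<^sup>2 / 4"] by auto
    then have N: "4 * inverse (real (Suc N)) < e\<^sup>2"
      by simp
    have small: "4 * (\<phi> (x n) - m) < e\<^sup>2" if "N \<le> n" for n
    proof -
      have "inverse (real (Suc n)) \<le> inverse (real (Suc N))"
        using that by (intro le_imp_inverse_le) auto
      then show ?thesis
        using x[of n] N by argo
    qed
    have "dist (x i) (x j) < e" if "N \<le> i" "N \<le> j" for i j
    proof -
      have "(norm (x i - x j))\<^sup>2 < e\<^sup>2"
        using gap[of "x i" "x j"] small[OF that(1)] small[OF that(2)] by linarith
      then show ?thesis
        using \<open>0 < e\<close> by (simp add: dist_norm power2_less_imp_less)
    qed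
    then show "\<exists>N. \<forall>i\<ge>N. \<forall>j\<ge>N. dist (x i) (x j) < e"
      by blast
  qed
  then obtain y where y: "x \<longlonglongrightarrow> y"
    using Cauchy_convergent_iff convergent_def by blast
  have "(\<lambda>n. \<phi> (x n)) \<longlonglongrightarrow> \<phi> y"
    unfolding \<phi>_def by (intro tendsto_intros y bounded_linear.tendsto[OF lin])
  moreover have "(\<lambda>n. m + inverse (real (Suc n))) \<longlonglongrightarrow> m + 0"
    by (intro tendsto_intros LIMSEQ_inverse_real_of_nat)
  ultimately have y_min: "\<phi> y \<le> m"
    using LIMSEQ_le[of "\<lambda>n. \<phi> (x n)" "\<phi> y" "\<lambda>n. m + inverse (real (Suc n))" m] x
    by (auto intro: less_imp_le)
  have Re_eq: "Re (f h) = Re (cinner h y)" for h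
  proof -
    have "0 \<le> s\<^sup>2 * (norm h)\<^sup>2 + s * (2 * Re (cinner h y) - 2 * Re (f h))" for s
    proof -
      have "\<phi> (s *\<^sub>R h + y) =
          \<phi> y + (s\<^sup>2 * (norm h)\<^sup>2 + s * (2 * Re (cinner h y) - 2 * Re (f h)))"
        unfolding \<phi>_def norm_add_sq
        by (simp add: linear_simps[OF lin] bounded_bilinear.scaleR_left[OF bounded_bilinear_cinner]
            algebra_simps power_mult_distrib)
      then show ?thesis
        using y_min m_le[of "s *\<^sub>R h + y"] by linarith
    qed
    then have "2 * Re (cinner h y) - 2 * Re (f h) = 0"
      by (rule linear_term_zero)
    then show ?thesis
      by simp
  qed
  have "f h = cinner h y" for h
  proof (rule complex_eqI)
    show "Re (f h) = Re (cinner h y)"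
      by (rule Re_eq)
    \<comment> \<open>Minimality controls real parts only; the imaginary part at \<open>h\<close> is
      read off from the real part at \<open>\<i> *\<^sub>C h\<close>.\<close>
    show "Im (f h) = Im (cinner h y)"
      using Re_eq[of "\<i> *\<^sub>C h"] by (simp add: bounded_clinear_scaleC[OF f] cinner_scaleC_left scaleC_complex_def)
  qed
  then show ?thesis
    by (rule that)
qed

lemma adjoint_exists:
  fixes A :: "'a::chilbert_space \<Rightarrow> 'a"
  assumes A: "bounded_clinear A"
  obtains B where "bounded_clinear B" and "\<And>x y. cinner (A x) y = cinner x (B y)"
proof -
  obtain K where K: "\<And>x. norm (A x) \<le> norm x * K"
    using bounded_linear.bounded[OF bounded_clinear_bounded_linear[OF A]] by blast
  have "\<exists>z. \<forall>x. cinner (A x) y = cinner x z" for y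
  proof -
    have "bounded_clinear (\<lambda>x. cinner (A x) y)"
    proof (rule bounded_clinearI)
      show "norm (cinner (A x) y) \<le> norm x * (K * norm y)" for x
        using cinner_Cauchy_Schwarz[of "A x" y] mult_right_mono[OF K[of x], of "norm y"]
        by (simp add: mult.assoc)
    qed (simp_all add: bounded_clinear_add[OF A] bounded_clinear_scaleC[OF A] cinner_add_left
        cinner_scaleC_left scaleC_complex_def)
    then show ?thesis
      by (metis Riesz_representation)
  qed
  then obtain B where B: "\<And>x y. cinner (A x) y = cinner x (B y)"
    by metis
  have right_eqI: "u = v" if "\<And>x. cinner x u = cinner x v" for u v :: 'a
    using that by (metis cinner_commute cinner_left_eqI)
  have "bounded_clinear B"
  proof (rule bounded_clinearI)
    show "B (x + y) = B x + B y" for x y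
      by (rule right_eqI) (simp add: B[symmetric] cinner_add_right)
    show "B (c *\<^sub>C x) = c *\<^sub>C B x" for c x
      by (rule right_eqI) (simp add: B[symmetric] cinner_scaleC_right)
    show "norm (B y) \<le> norm y * K" for y
    proof (cases "B y = 0")
      case True
      then show ?thesis
        using K[of y] by (metis norm_ge_zero norm_zero order_trans)
    next
      case False
      have "norm (B y) * norm (B y) = norm (cinner (B y) (B y))"
        by (simp add: cinner_self power2_eq_square norm_mult)
      also have "\<dots> = norm (cinner (A (B y)) y)"
        by (simp add: B)
      also have "\<dots> \<le> norm (A (B y)) * norm y"
        by (rule cinner_Cauchy_Schwarz)
      also have "\<dots> \<le> (norm (B y) * K) * norm y"
        by (intro mult_right_mono K) simp
      finally show ?thesis
        using False by (simp add: mult.commute mult.left_commute)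
    qed
  qed
  then show ?thesis
    using B by (rule that)
qed

text \<open>A solution of \<open>Q x = y\<close> is a fixed point of \<open>\<lambda>x. x - l *\<^sub>R (Q x - y)\<close>, which is a contraction
  for small positive \<open>l\<close>.\<close>

lemma Lax_Milgram_surj:
  fixes Q :: "'a::chilbert_space \<Rightarrow> 'a"
  assumes Q: "bounded_clinear Q" and "0 < d"
    and coercive: "\<And>x. d * (norm x)\<^sup>2 \<le> Re (cinner (Q x) x)"
  shows "\<exists>x. Q x = y"
proof -
  obtain K where "0 < K" and K: "\<And>x. norm (Q x) \<le> norm x * K"
    using bounded_linear.pos_bounded[OF bounded_clinear_bounded_linear[OF Q]] by blast
  \<comment> \<open>Expanding the square, the map changes squared norms by at most the factor
    \<open>1 - 2 * l * d + l\<^sup>2 * K\<^sup>2\<close>. This \<open>l\<close> gives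
    \<open>l * K\<^sup>2 \<le> d\<close>, hence the factor \<open>1 - l * d\<close>; the summand
    \<open>d\<^sup>2\<close> keeps that factor positive without a comparison of \<open>d\<close> and
    \<open>K\<close>.\<close>
  define l where "l = d / (K\<^sup>2 + d\<^sup>2)"
  define c where "c = sqrt (1 - l * d)"
  have pos: "0 < K\<^sup>2 + d\<^sup>2"
    using \<open>0 < K\<close> by (simp add: add_pos_nonneg)
  have "0 < l"
    unfolding l_def using \<open>0 < d\<close> pos by simp
  have "l * K\<^sup>2 \<le> d"
    unfolding l_def using \<open>0 < d\<close> pos by (simp add: field_simps)
  have "l * d < 1"
    unfolding l_def using \<open>0 < K\<close> pos by (simp add: field_simps power2_eq_square)
  have contr: "norm (x - l *\<^sub>R Q x) \<le> c * norm x" for x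
  proof -
    have "(norm (x - l *\<^sub>R Q x))\<^sup>2 = (norm x)\<^sup>2 + l\<^sup>2 * (norm (Q x))\<^sup>2 - 2 * l * Re (cinner (Q x) x)"
    proof -
      have "Re (cinner x (l *\<^sub>R Q x)) = l * Re (cinner (Q x) x)"
        by (subst cinner_commute)
          (simp add: bounded_bilinear.scaleR_left[OF bounded_bilinear_cinner])
      then show ?thesis
        by (simp add: norm_diff_sq power_mult_distrib)
    qed
    also have "\<dots> \<le> (norm x)\<^sup>2 + l * (d * (norm x)\<^sup>2) - 2 * l * (d * (norm x)\<^sup>2)"
    proof -
      have "l\<^sup>2 * (norm (Q x))\<^sup>2 \<le> l\<^sup>2 * (norm x * K)\<^sup>2"
        by (intro mult_left_mono power_mono K) auto
      also have "\<dots> = l * ((l * K\<^sup>2) * (norm x)\<^sup>2)"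
        by (simp add: power2_eq_square)
      also have "\<dots> \<le> l * (d * (norm x)\<^sup>2)"
        using \<open>0 < l\<close> \<open>l * K\<^sup>2 \<le> d\<close> by (intro mult_left_mono mult_right_mono) auto
      moreover have "2 * l * (d * (norm x)\<^sup>2) \<le> 2 * l * Re (cinner (Q x) x)"
        using \<open>0 < l\<close> coercive[of x] by (intro mult_left_mono) auto
      ultimately show ?thesis
        by linarith
    qed
    also have "\<dots> = (c * norm x)\<^sup>2"
      unfolding c_def using \<open>l * d < 1\<close> by (simp add: power_mult_distrib algebra_simps)
    finally show ?thesis
      by (rule power2_le_imp_le) (simp add: c_def less_imp_le[OF \<open>l * d < 1\<close>])
  qed
  have "\<exists>!x. x \<in> UNIV \<and> x - l *\<^sub>R (Q x - y) = x"
  proof (rule Banach_fix[where c = c])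
    show "0 \<le> c" "c < 1"
      unfolding c_def using \<open>0 < l\<close> \<open>0 < d\<close> \<open>l * d < 1\<close> by auto
    show "dist (u - l *\<^sub>R (Q u - y)) (v - l *\<^sub>R (Q v - y)) \<le> c * dist u v" for u v
    proof -
      have "u - l *\<^sub>R (Q u - y) - (v - l *\<^sub>R (Q v - y)) = (u - v) - l *\<^sub>R Q (u - v)"
        by (simp add: bounded_clinear_diff[OF Q] algebra_simps)
      then show ?thesis
        using contr[of "u - v"] by (simp only: dist_norm)
    qed
  qed (auto simp: complete_UNIV)
  then show ?thesis
    using \<open>0 < l\<close> by auto
qed


subsection \<open>Orthonormal families and the essential numerical range\<close>

definition orthonormal_on :: "('i \<Rightarrow> 'a::complex_inner) \<Rightarrow> 'i set \<Rightarrow> bool"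
  where "orthonormal_on f I \<longleftrightarrow> (\<forall>i\<in>I. \<forall>j\<in>I. cinner (f i) (f j) = (if i = j then 1 else 0))"

definition projection_onto :: "('i \<Rightarrow> 'a::complex_inner) \<Rightarrow> 'i set \<Rightarrow> 'a \<Rightarrow> 'a"
  where "projection_onto f I x = (\<Sum>i\<in>I. cinner x (f i) *\<^sub>C f i)"

lemma bounded_clinear_sum:
  assumes "\<And>i. i \<in> I \<Longrightarrow> bounded_clinear (B i)"
  shows "bounded_clinear (\<lambda>x. \<Sum>i\<in>I. c i *\<^sub>C B i x)"
  unfolding bounded_clinear_def
proof (intro conjI allI)
  show "bounded_linear (\<lambda>x. \<Sum>i\<in>I. c i *\<^sub>C B i x)"
    using assms
    by (intro bounded_linear_sum bounded_linear_compose[OF bounded_bilinear.bounded_linear_right[OF bounded_bilinear_scaleC]])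
      (auto simp: bounded_clinear_def)
  show "(\<Sum>i\<in>I. c i *\<^sub>C B i (d *\<^sub>C x)) = d *\<^sub>C (\<Sum>i\<in>I. c i *\<^sub>C B i x)" for d x
    using assms by (simp add: scaleC_sum_right scaleC_scaleC bounded_clinear_scaleC mult.commute)
qed

lemma bounded_clinear_projection: "bounded_clinear (projection_onto f I)"
proof -
  have "bounded_clinear (\<lambda>x. cinner x (f i) *\<^sub>C f i)" for i
    unfolding bounded_clinear_def
    by (intro conjI allI
        bounded_linear_compose[OF bounded_bilinear.bounded_linear_left[OF bounded_bilinear_scaleC]]
        bounded_bilinear.bounded_linear_left[OF bounded_bilinear_cinner])
      (simp add: cinner_scaleC_left scaleC_scaleC)
  from bounded_clinear_sum[of I, OF this, where c = "\<lambda>_. 1"] show ?thesis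
    by (simp add: projection_onto_def[abs_def] scaleC_one)
qed

lemma cinner_projection_self:
  "cinner (projection_onto f I x) x = of_real (\<Sum>i\<in>I. (norm (cinner x (f i)))\<^sup>2)"
proof -
  have "cinner x (f i) * cinner (f i) x = of_real ((norm (cinner x (f i)))\<^sup>2)" for i
    by (subst cinner_commute[of "f i" x]) (simp add: complex_norm_square[unfolded of_real_power])
  then show ?thesis
    by (simp add: projection_onto_def cinner_sum_left cinner_scaleC_left)
qed

lemma cinner_projection:
  assumes "finite I" and "orthonormal_on f I" and "j \<in> I"
  shows "cinner (projection_onto f I x) (f j) = cinner x (f j)"
proof -
  have "cinner (projection_onto f I x) (f j) = (\<Sum>i\<in>I. if i = j then cinner x (f i) else 0)"
    unfolding projection_onto_def cinner_sum_left cinner_scaleC_left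
    using assms(2,3) by (intro sum.cong) (auto simp: orthonormal_on_def)
  then show ?thesis
    using assms(1,3) by simp
qed

lemma cinner_residual_projection:
  assumes "finite I" and "orthonormal_on f I"
  shows "cinner (x - projection_onto f I x) (projection_onto f I y) = 0"
proof -
  have "cinner (x - projection_onto f I x) (f i) = 0" if "i \<in> I" for i
    using cinner_projection[OF assms that] by (simp add: cinner_diff_left)
  then show ?thesis
    by (simp add: projection_onto_def[of _ _ y] cinner_sum_right cinner_scaleC_right)
qed

lemma norm_projection_Pythagoras:
  assumes "finite I" and "orthonormal_on f I"
  shows "(norm x)\<^sup>2 = (norm (x - projection_onto f I x))\<^sup>2 + (norm (projection_onto f I x))\<^sup>2"
  using norm_add_sq[of "x - projection_onto f I x" "projection_onto f I x"]
    cinner_residual_projection[OF assms, of x x] by simp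

lemma norm_projection_sq:
  assumes "finite I" and "orthonormal_on f I"
  shows "(norm (projection_onto f I x))\<^sup>2 = (\<Sum>i\<in>I. (norm (cinner x (f i)))\<^sup>2)"
proof -
  have "Re (cinner x (projection_onto f I x)) = Re (cinner (projection_onto f I x) (projection_onto f I x))"
    using cinner_residual_projection[OF assms, of x x] by (simp add: cinner_diff_left)
  moreover have "Re (cinner x (projection_onto f I x)) = Re (cinner (projection_onto f I x) x)"
    by (subst cinner_commute) simp
  ultimately show ?thesis
    by (simp add: cinner_self cinner_projection_self del: of_real_power)
qed

lemma Bessel_inequality:
  assumes "finite I" and "orthonormal_on f I"
  shows "(\<Sum>i\<in>I. (norm (cinner x (f i)))\<^sup>2) \<le> (norm x)\<^sup>2"
  using norm_projection_Pythagoras[OF assms, of x] norm_projection_sq[OF assms, of x] by simp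

text \<open>Bessel's inequality bounds the partial sums of the squared coefficients, so these are
  summable and tend to zero.\<close>

lemma orthonormal_sequence_weakly_null:
  assumes "orthonormal_on f (UNIV :: nat set)"
  shows "(\<lambda>n. cinner y (f n)) \<longlonglongrightarrow> 0"
proof -
  have "summable (\<lambda>n. (norm (cinner y (f n)))\<^sup>2)"
  proof (rule summableI_nonneg_bounded)
    show "(\<Sum>i<n. (norm (cinner y (f i)))\<^sup>2) \<le> (norm y)\<^sup>2" for n
      using assms by (intro Bessel_inequality) (auto simp: orthonormal_on_def)
  qed simp
  then have "(\<lambda>n. (norm (cinner y (f n)))\<^sup>2) \<longlonglongrightarrow> 0"
    by (rule summable_LIMSEQ_zero)
  then have "(\<lambda>n. sqrt ((norm (cinner y (f n)))\<^sup>2)) \<longlonglongrightarrow> sqrt 0"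
    by (rule tendsto_real_sqrt)
  then show ?thesis
    by (simp add: tendsto_norm_zero_iff)
qed

lemma orthonormal_on_norm: "orthonormal_on f I \<Longrightarrow> i \<in> I \<Longrightarrow> norm (f i) = 1"
proof -
  assume "orthonormal_on f I" "i \<in> I"
  then have "complex_of_real ((norm (f i))\<^sup>2) = of_real 1"
    unfolding cinner_self[symmetric] by (simp add: orthonormal_on_def)
  then have "(norm (f i))\<^sup>2 = 1"
    by (simp only: of_real_eq_iff)
  then show ?thesis
    using norm_ge_zero[of "f i"] by (simp add: power2_eq_1_iff)
qed

text \<open>A compact perturbation is invisible along an orthonormal sequence. On a subsequence
  \<open>K (x n)\<close> converges in norm to some \<open>y\<close>, and the pairing of
  \<open>y\<close> with \<open>x n\<close> tends to zero because the sequence is weakly null. So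
  \<open>A + K\<close> has the same limit \<open>l\<close> of quadratic values as
  \<open>A\<close>.\<close>

lemma orthonormal_limit_in_essential_numerical_range:
  fixes x :: "nat \<Rightarrow> 'a::complex_inner"
  assumes x: "orthonormal_on x UNIV" and lim: "(\<lambda>n. cinner (A (x n)) (x n)) \<longlonglongrightarrow> l"
  shows "l \<in> essential_numerical_range A"
  unfolding essential_numerical_range_def
proof (rule INT_I)
  fix K :: "'a \<Rightarrow> 'a"
  assume "K \<in> {K. compact_clinear K}"
  then have compact: "compact (closure (K ` cball 0 1))"
    by (simp add: compact_clinear_def)
  have norm1: "norm (x n) = 1" for n
    using x by (simp add: orthonormal_on_norm)
  then have "\<forall>n. K (x n) \<in> closure (K ` cball 0 1)"
    by (intro allI subsetD[OF closure_subset] imageI) simp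
  then obtain y r where r: "strict_mono r" and y: "((\<lambda>n. K (x n)) \<circ> r) \<longlonglongrightarrow> y"
    using compact unfolding compact_def by metis
  have "(\<lambda>n. cinner (K (x (r n)) - y) (x (r n))) \<longlonglongrightarrow> 0"
  proof (rule Lim_null_comparison)
    show "\<forall>\<^sub>F n in sequentially. norm (cinner (K (x (r n)) - y) (x (r n))) \<le> norm (K (x (r n)) - y)"
      using cinner_Cauchy_Schwarz[of "K (x (r n)) - y" "x (r n)" for n] norm1 by simp
    show "(\<lambda>n. norm (K (x (r n)) - y)) \<longlonglongrightarrow> 0"
      using y by (simp add: LIM_zero tendsto_norm_zero comp_def)
  qed
  moreover have "(\<lambda>n. cinner y (x (r n))) \<longlonglongrightarrow> 0"
    using LIMSEQ_subseq_LIMSEQ[OF orthonormal_sequence_weakly_null[OF x] r, of y] by (simp add: comp_def)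
  moreover have "(\<lambda>n. cinner (A (x (r n))) (x (r n))) \<longlonglongrightarrow> l"
    using LIMSEQ_subseq_LIMSEQ[OF lim r] by (simp add: comp_def)
  ultimately have "(\<lambda>n. cinner (A (x (r n))) (x (r n)) + (cinner (K (x (r n)) - y) (x (r n)) +
      cinner y (x (r n)))) \<longlonglongrightarrow> l + (0 + 0)"
    by (intro tendsto_add)
  then have "(\<lambda>n. cinner (A (x (r n)) + K (x (r n))) (x (r n))) \<longlonglongrightarrow> l"
    by (simp add: cinner_add_left cinner_diff_left)
  then show "l \<in> closure (numerical_range (\<lambda>x. A x + K x))"
    unfolding closure_sequential numerical_range_def
    by (intro exI[of _ "\<lambda>n. cinner (A (x (r n)) + K (x (r n))) (x (r n))"]) (auto simp: norm1)
qed

lemma numerical_range_bounded: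
  assumes "bounded_clinear A"
  shows "bounded (numerical_range A)"
proof -
  obtain K where K: "\<And>x. norm (A x) \<le> norm x * K"
    using bounded_linear.bounded[OF bounded_clinear_bounded_linear[OF assms]] by blast
  have "norm z \<le> K" if z: "z \<in> numerical_range A" for z
  proof -
    obtain x where "z = cinner (A x) x" "norm x = 1"
      using z by (auto simp: numerical_range_def)
    then show ?thesis
      using cinner_Cauchy_Schwarz[of "A x" x] K[of x] by simp
  qed
  then show ?thesis
    by (auto simp: bounded_iff)
qed

text \<open>If there were no gap, one could choose an orthonormal sequence along which \<open>L\<close> tends to \<open>0\<close>,
  and any limit point would be a zero of \<open>L\<close> in the essential numerical range.\<close>

lemma essential_numerical_range_gap:
  fixes A :: "'a::complex_inner \<Rightarrow> 'a" and L :: "complex \<Rightarrow> real"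
  assumes A: "bounded_clinear A" and L: "continuous_on UNIV L"
    and nonneg: "\<And>z. z \<in> numerical_range A \<Longrightarrow> 0 \<le> L z"
    and ess: "\<And>z. z \<in> essential_numerical_range A \<Longrightarrow> L z \<noteq> 0"
  shows "\<exists>(n::nat) f e. orthonormal_on f {..<n} \<and> 0 < e \<and>
    (\<forall>x. norm x = 1 \<longrightarrow> (\<forall>i<n. cinner x (f i) = 0) \<longrightarrow> e \<le> L (cinner (A x) x))"
proof (rule ccontr)
  assume contra: "\<not> ?thesis"
  have no_gap: "\<exists>x. norm x = 1 \<and> (\<forall>i<n. cinner x (f i) = 0) \<and> L (cinner (A x) x) < e"
    if "orthonormal_on f {..<n}" "0 < e" for f and n :: nat and e
    using contra that by (meson not_le)
  \<comment> \<open>Orthogonality is demanded against earlier terms only, so the condition on term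
    \<open>n\<close> depends on \<open>f\<close> below \<open>n\<close>, as the recursive choice
    requires; conjugate symmetry supplies the other half of orthonormality.\<close>
  define P where "P f n x \<longleftrightarrow> norm x = 1 \<and> (\<forall>i<n. cinner x (f i) = 0) \<and>
    L (cinner (A x) x) < inverse (real (Suc n))" for f :: "nat \<Rightarrow> 'a" and n x
  have orth: "orthonormal_on f S" if f: "\<And>m. m \<in> S \<Longrightarrow> P f m (f m)" for f and S :: "nat set"
    unfolding orthonormal_on_def
  proof (intro ballI)
    fix i j
    assume ij: "i \<in> S" "j \<in> S"
    have zero: "cinner (f k) (f l) = 0" if "l < k" "k \<in> S" for k l
      using f[OF that(2)] that(1) by (simp add: P_def)
    have "cinner (f i) (f i) = 1"
      using f[OF ij(1)] by (simp add: P_def cinner_self)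
    then show "cinner (f i) (f j) = (if i = j then 1 else 0)"
      using zero[of i j] zero[of j i] cinner_commute[of "f i" "f j"] ij
      by (cases i j rule: linorder_cases) auto
  qed
  have "\<exists>x. \<forall>n. P x n (x n)"
  proof (rule dependent_wellorder_choice)
    show "P f n x = P g n x" if "\<And>m. m < n \<Longrightarrow> f m = g m" for f g n x
      using that by (simp add: P_def)
    show "\<exists>x. P f n x" if "\<And>m. m < n \<Longrightarrow> P f m (f m)" for n f
    proof -
      have "orthonormal_on f {..<n}"
        using that by (intro orth) auto
      from no_gap[OF this, of "inverse (real (Suc n))"] show ?thesis
        unfolding P_def by auto
    qed
  qed
  then obtain x where x: "\<And>n. P x n (x n)"
    by blast
  define z where "z n = cinner (A (x n)) (x n)" for n
  have z_in: "z n \<in> numerical_range A" for n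
    using x[of n] by (auto simp: numerical_range_def z_def P_def)
  then have "bounded (range z)"
    by (intro bounded_subset[OF numerical_range_bounded[OF A]]) auto
  then obtain l r where r: "strict_mono r" and l: "(z \<circ> r) \<longlonglongrightarrow> l"
    using bounded_imp_convergent_subsequence by blast
  have "(\<lambda>n. L ((z \<circ> r) n)) \<longlonglongrightarrow> L l"
    using l by (intro continuous_on_tendsto_compose[OF L]) (auto simp: comp_def)
  moreover have "(\<lambda>n. L ((z \<circ> r) n)) \<longlonglongrightarrow> 0"
  proof (rule real_tendsto_sandwich)
    show "\<forall>\<^sub>F n in sequentially. L ((z \<circ> r) n) \<le> inverse (real (Suc n))"
    proof (intro always_eventually allI)
      fix n
      have "inverse (real (Suc (r n))) \<le> inverse (real (Suc n))"
        using seq_suble[OF r, of n] by simp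
      moreover have "L ((z \<circ> r) n) \<le> inverse (real (Suc (r n)))"
        using x[of "r n"] by (simp add: P_def z_def)
      ultimately show "L ((z \<circ> r) n) \<le> inverse (real (Suc n))"
        by (rule order_trans[rotated])
    qed
    show "\<forall>\<^sub>F n in sequentially. 0 \<le> L ((z \<circ> r) n)"
      using nonneg z_in by simp
  qed (rule tendsto_const LIMSEQ_inverse_real_of_nat)+
  ultimately have "L l = 0"
    by (rule LIMSEQ_unique)
  moreover have "orthonormal_on (x \<circ> r) UNIV"
    using orth[of UNIV x] x strict_mono_eq[OF r] by (simp add: orthonormal_on_def)
  then have "l \<in> essential_numerical_range A"
    by (rule orthonormal_limit_in_essential_numerical_range) (use l in \<open>simp add: z_def comp_def\<close>)
  ultimately show False
    using ess by blast
qed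


subsection \<open>Semidefinite operators with a finite-dimensional defect\<close>

text \<open>For a nonnegative form, dropping the term at \<open>x + y\<close> bounds the value at
  \<open>x - y\<close> by twice the sum of the values at \<open>x\<close> and \<open>y\<close>. This
  controls differences without any estimate of mixed terms.\<close>

lemma form_parallelogram:
  assumes "bounded_clinear P"
  shows "Re (cinner (P (x + y)) (x + y)) + Re (cinner (P (x - y)) (x - y)) =
    2 * Re (cinner (P x) x) + 2 * Re (cinner (P y) y)"
  by (simp add: bounded_clinear_add[OF assms] bounded_clinear_diff[OF assms]
      cinner_add_left cinner_add_right cinner_diff_left cinner_diff_right)

text \<open>The form has its minimum at \<open>x\<close>, so its first variation vanishes there. In
  the direction \<open>P x\<close> that variation is, by symmetry of \<open>P\<close>, twice the
  square of \<open>norm (P x)\<close>.\<close>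

lemma semidefinite_kernel:
  assumes P: "bounded_clinear P" and sym: "\<And>x y. cinner (P x) y = cinner x (P y)"
    and nonneg: "\<And>x. 0 \<le> Re (cinner (P x) x)" and zero: "Re (cinner (P x) x) = 0"
  shows "P x = 0"
proof -
  have "0 \<le> s\<^sup>2 * Re (cinner (P (P x)) (P x)) + s * (2 * (norm (P x))\<^sup>2)" for s
  proof -
    have lin: "P (s *\<^sub>R P x) = s *\<^sub>R P (P x)"
      using bounded_clinear_bounded_linear[OF P] by (simp add: linear_simps)
    have "Re (cinner (P (x + s *\<^sub>R P x)) (x + s *\<^sub>R P x)) =
        Re (cinner (P x) x) + s * Re (cinner (P x) (P x)) + s * Re (cinner (P (P x)) x) +
        s\<^sup>2 * Re (cinner (P (P x)) (P x))"
      unfolding bounded_clinear_add[OF P] lin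
      by (simp add: cinner_add_left cinner_add_right algebra_simps power2_eq_square
          bounded_bilinear.scaleR_left[OF bounded_bilinear_cinner]
          bounded_bilinear.scaleR_right[OF bounded_bilinear_cinner])
    moreover have "Re (cinner (P x) (P x)) = (norm (P x))\<^sup>2" "Re (cinner (P (P x)) x) = (norm (P x))\<^sup>2"
      by (simp_all add: sym[of "P x" x] cinner_self del: of_real_power)
    ultimately show ?thesis
      using nonneg[of "x + s *\<^sub>R P x"] zero by (simp add: algebra_simps)
  qed
  then have "2 * (norm (P x))\<^sup>2 = 0"
    by (rule linear_term_zero)
  then show ?thesis
    by simp
qed

text \<open>Split \<open>x\<close> into its projection \<open>p\<close> and the residual. The gap
  bounds the residual by the form at \<open>x - p\<close>, the parallelogram identity bounds that by
  the forms at \<open>x\<close> and \<open>p\<close>, and the form at \<open>p\<close> is at most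
  \<open>M * (norm p)\<^sup>2\<close>.\<close>

lemma coercive_add_projection:
  assumes P: "bounded_clinear P" and nonneg: "\<And>x. 0 \<le> Re (cinner (P x) x)"
    and f: "finite I" "orthonormal_on f I" and "0 < e"
    and gap: "\<And>x. norm x = 1 \<Longrightarrow> \<forall>i\<in>I. cinner x (f i) = 0 \<Longrightarrow> e \<le> Re (cinner (P x) x)"
  shows "\<exists>d>0. \<forall>x. d * (norm x)\<^sup>2 \<le> Re (cinner (P x) x) + (norm (projection_onto f I x))\<^sup>2"
proof -
  obtain M where "0 < M" and M: "\<And>x. norm (P x) \<le> norm x * M"
    using bounded_linear.pos_bounded[OF bounded_clinear_bounded_linear[OF P]] by blast
  \<comment> \<open>The summand 2 pays for the form at \<open>x\<close>, \<open>2 * M\<close> for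
    the form at \<open>p\<close>, and \<open>e\<close> for restoring \<open>(norm p)\<^sup>2\<close>
    to obtain the full square of \<open>norm x\<close>.\<close>
  define C where "C = 2 + 2 * M + e"
  have "0 < C"
    unfolding C_def using \<open>0 < M\<close> \<open>0 < e\<close> by simp
  have gap': "e * (norm y)\<^sup>2 \<le> Re (cinner (P y) y)" if y: "\<And>i. i \<in> I \<Longrightarrow> cinner y (f i) = 0" for y
  proof (cases "y = 0")
    case False
    define u where "u = (1 / norm y) *\<^sub>R y"
    have "norm u = 1" "\<forall>i\<in>I. cinner u (f i) = 0"
      using False y unfolding u_def
      by (simp_all add: bounded_bilinear.scaleR_left[OF bounded_bilinear_cinner])
    then have "e \<le> Re (cinner (P u) u)"
      by (rule gap)
    also have "P u = (1 / norm y) *\<^sub>R P y"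
      unfolding u_def using bounded_clinear_bounded_linear[OF P] by (simp add: linear_simps)
    also have "Re (cinner ((1 / norm y) *\<^sub>R P y) u) = Re (cinner (P y) y) / (norm y)\<^sup>2"
      unfolding u_def by (simp add: bounded_bilinear.scaleR_left[OF bounded_bilinear_cinner]
          bounded_bilinear.scaleR_right[OF bounded_bilinear_cinner] power2_eq_square)
    finally show ?thesis
      using False by (simp add: field_simps)
  qed (simp add: cinner_zero_right)
  have main: "e * (norm x)\<^sup>2 \<le> C * (Re (cinner (P x) x) + (norm (projection_onto f I x))\<^sup>2)" for x
  proof -
    define p where "p = projection_onto f I x"
    have "cinner (x - p) (f i) = 0" if "i \<in> I" for i
      using cinner_projection[OF f that, of x] by (simp add: p_def cinner_diff_left)
    then have "e * (norm (x - p))\<^sup>2 \<le> Re (cinner (P (x - p)) (x - p))"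
      by (rule gap')
    also have "\<dots> \<le> 2 * Re (cinner (P x) x) + 2 * Re (cinner (P p) p)"
      using form_parallelogram[OF P, of x p] nonneg[of "x + p"] by simp
    also have "Re (cinner (P p) p) \<le> M * (norm p)\<^sup>2"
    proof -
      have "Re (cinner (P p) p) \<le> norm (P p) * norm p"
        using complex_Re_le_cmod cinner_Cauchy_Schwarz by (rule order_trans)
      also have "\<dots> \<le> norm p * M * norm p"
        by (intro mult_right_mono M) simp
      finally show ?thesis
        by (simp add: power2_eq_square mult_ac)
    qed
    finally have "e * (norm (x - p))\<^sup>2 \<le> 2 * Re (cinner (P x) x) + 2 * (M * (norm p)\<^sup>2)"
      by simp
    moreover have "(norm x)\<^sup>2 = (norm (x - p))\<^sup>2 + (norm p)\<^sup>2"
      unfolding p_def by (rule norm_projection_Pythagoras[OF f])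
    moreover have "2 * Re (cinner (P x) x) \<le> C * Re (cinner (P x) x)"
      using nonneg[of x] \<open>0 < M\<close> \<open>0 < e\<close> by (intro mult_right_mono) (simp_all add: C_def)
    moreover have "2 * (M * (norm p)\<^sup>2) + e * (norm p)\<^sup>2 \<le> C * (norm p)\<^sup>2"
      by (simp add: C_def algebra_simps)
    ultimately show ?thesis
      unfolding p_def[symmetric] by (simp add: algebra_simps)
  qed
  show ?thesis
  proof (intro exI[of _ "e / C"] conjI allI)
    show "0 < e / C"
      using \<open>0 < e\<close> \<open>0 < C\<close> by simp
    show "e / C * (norm x)\<^sup>2 \<le> Re (cinner (P x) x) + (norm (projection_onto f I x))\<^sup>2" for x
      using main[of x] \<open>0 < C\<close> by (simp add: field_simps)
  qed
qed

section \<open>Strong convergence of minimising sequences\<close>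

lemma common_convergent_subsequence:
  fixes c :: "nat \<Rightarrow> nat \<Rightarrow> 'b::heine_borel"
  assumes "\<And>i. i < n \<Longrightarrow> bounded (range (c i))"
  shows "\<exists>r. strict_mono (r :: nat \<Rightarrow> nat) \<and> (\<forall>i<n. convergent (c i \<circ> r))"
  using assms
proof (induction n)
  case 0
  then show ?case
    by (auto intro: strict_mono_id)
next
  case (Suc n)
  then obtain r where r: "strict_mono (r :: nat \<Rightarrow> nat)" "\<forall>i<n. convergent (c i \<circ> r)"
    by (metis less_SucI)
  have "bounded (range (c n \<circ> r))"
    by (rule bounded_subset[OF Suc.prems[of n]]) auto
  then obtain l s where s: "strict_mono s" "((c n \<circ> r) \<circ> s) \<longlonglongrightarrow> l"
    using bounded_imp_convergent_subsequence by blast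
  have "convergent (c i \<circ> (r \<circ> s))" if "i < Suc n" for i
  proof (cases "i = n")
    case True
    then show ?thesis
      using s(2) by (auto simp: convergent_def comp_assoc)
  next
    case False
    then have "convergent ((c i \<circ> r) \<circ> s)"
      using r(2) that by (intro convergent_subseq_convergent[OF _ s(1)]) auto
    then show ?thesis
      by (simp add: comp_assoc)
  qed
  then show ?case
    using strict_mono_o[OF r(1) s(1)] by blast
qed

text \<open>Only finitely many coordinates escape the control of the form, and these converge along
  a common subsequence. On differences, coercivity and the parallelogram identity bound the distance
  by form values, which tend to zero, and by differences of projections, which are Cauchy.\<close>

lemma minimising_subsequence_convergent:
  fixes x :: "nat \<Rightarrow> 'a::chilbert_space" and f :: "nat \<Rightarrow> 'a"
  assumes P: "bounded_clinear P" and nonneg: "\<And>x. 0 \<le> Re (cinner (P x) x)" and "0 < d"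
    and coercive: "\<And>x. d * (norm x)\<^sup>2 \<le>
      Re (cinner (P x) x) + (norm (projection_onto f {..<n} x))\<^sup>2"
    and x: "\<And>k. norm (x k) = 1" and lim: "(\<lambda>k. Re (cinner (P (x k)) (x k))) \<longlonglongrightarrow> 0"
  obtains r y where "strict_mono r" and "(x \<circ> r) \<longlonglongrightarrow> y"
proof -
  define q where "q u = Re (cinner (P u) u)" for u
  define proj where "proj = projection_onto f {..<n}"
  have "bounded (range (\<lambda>k. cinner (x k) (f i)))" for i
    using cinner_Cauchy_Schwarz[of "x k" "f i" for k] x by (auto simp: bounded_iff)
  then obtain r where r: "strict_mono (r :: nat \<Rightarrow> nat)"
    and "\<forall>i<n. convergent ((\<lambda>k. cinner (x k) (f i)) \<circ> r)"
    using common_convergent_subsequence[of n "\<lambda>i k. cinner (x k) (f i)"] by blast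
  then obtain c where c: "\<And>i. i < n \<Longrightarrow> (\<lambda>k. cinner (x (r k)) (f i)) \<longlonglongrightarrow> c i"
    unfolding convergent_def comp_def by metis
  then have "(\<lambda>k. proj (x (r k))) \<longlonglongrightarrow> (\<Sum>i<n. c i *\<^sub>C f i)"
    unfolding proj_def projection_onto_def by (intro tendsto_sum tendsto_scaleC) auto
  then have Cauchy_proj: "Cauchy (\<lambda>k. proj (x (r k)))"
    by (rule LIMSEQ_imp_Cauchy)
  have q0: "(\<lambda>k. q (x (r k))) \<longlonglongrightarrow> 0"
    using LIMSEQ_subseq_LIMSEQ[OF lim r] by (simp add: comp_def q_def)
  have gap: "d * (norm (u - v))\<^sup>2 \<le> 2 * q u + 2 * q v + (norm (proj u - proj v))\<^sup>2" for u v
    using coercive[of "u - v"] form_parallelogram[OF P, of u v] nonneg[of "u + v"]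
    by (simp add: q_def proj_def bounded_clinear_diff[OF bounded_clinear_projection])
  have "Cauchy (\<lambda>k. x (r k))"
  proof (rule metric_CauchyI)
    fix \<epsilon> :: real
    assume "0 < \<epsilon>"
    \<comment> \<open>The budget is \<open>\<eta>\<close>: each of the two form values, below
      \<open>\<eta> / 8\<close>, enters with factor 2, and the squared difference of projections
      takes the remaining half.\<close>
    define \<eta> where "\<eta> = d * \<epsilon>\<^sup>2"
    have "0 < \<eta>"
      unfolding \<eta>_def using \<open>0 < d\<close> \<open>0 < \<epsilon>\<close> by simp
    then have "\<forall>\<^sub>F k in sequentially. q (x (r k)) < \<eta> / 8"
      using q0 by (intro order_tendstoD) auto
    then obtain N1 where N1: "\<And>k. N1 \<le> k \<Longrightarrow> q (x (r k)) < \<eta> / 8"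
      by (auto simp: eventually_sequentially)
    obtain N2 where N2: "\<And>k l. N2 \<le> k \<Longrightarrow> N2 \<le> l \<Longrightarrow> norm (proj (x (r k)) - proj (x (r l))) < sqrt (\<eta> / 2)"
      using CauchyD[OF Cauchy_proj, of "sqrt (\<eta> / 2)"] \<open>0 < \<eta>\<close> by auto
    have "dist (x (r k)) (x (r l)) < \<epsilon>" if kl: "max N1 N2 \<le> k" "max N1 N2 \<le> l" for k l
    proof -
      have "(norm (proj (x (r k)) - proj (x (r l))))\<^sup>2 < (sqrt (\<eta> / 2))\<^sup>2"
        using N2[of k l] kl by (intro power_strict_mono) auto
      then have "(norm (proj (x (r k)) - proj (x (r l))))\<^sup>2 < \<eta> / 2"
        using \<open>0 < \<eta>\<close> by simp
      then have "d * (norm (x (r k) - x (r l)))\<^sup>2 < d * \<epsilon>\<^sup>2"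
        using gap[of "x (r k)" "x (r l)"] N1[of k] N1[of l] kl unfolding \<eta>_def[symmetric] by simp
      then have "(norm (x (r k) - x (r l)))\<^sup>2 < \<epsilon>\<^sup>2"
        using \<open>0 < d\<close> by simp
      then show ?thesis
        using \<open>0 < \<epsilon>\<close> by (simp add: dist_norm power2_less_imp_less)
    qed
    then show "\<exists>N. \<forall>k\<ge>N. \<forall>l\<ge>N. dist (x (r k)) (x (r l)) < \<epsilon>"
      by blast
  qed
  then obtain y where "(\<lambda>k. x (r k)) \<longlonglongrightarrow> y"
    using Cauchy_convergent_iff convergent_def by blast
  then show ?thesis
    using r by (intro that[of r y]) (simp_all add: comp_def)
qed

subsection \<open>Holomorphic families of coercive operators\<close>

lemma coercive_norm_le:
  assumes "0 < d" and "\<And>x. d * (norm x)\<^sup>2 \<le> Re (cinner (Q x) x)"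
  shows "d * norm x \<le> norm (Q x)"
proof (cases "x = 0")
  case False
  have "d * (norm x)\<^sup>2 \<le> norm (Q x) * norm x"
    using assms(2)[of x] complex_Re_le_cmod[of "cinner (Q x) x"] cinner_Cauchy_Schwarz[of "Q x" x]
    by linarith
  then show ?thesis
    using False by (simp add: power2_eq_square)
qed simp

lemma coercive_injective:
  assumes "bounded_clinear Q" and "0 < d" and "\<And>x. d * (norm x)\<^sup>2 \<le> Re (cinner (Q x) x)"
    and "Q x = Q y"
  shows "x = y"
  using coercive_norm_le[of d Q "x - y", OF assms(2,3)] assms(2,4)
  by (simp add: bounded_clinear_diff[OF assms(1)] mult_le_0_iff)

lemma inverse_bounded_clinear:
  assumes Q: "bounded_clinear Q" and "0 < d" and coercive: "\<And>x. d * (norm x)\<^sup>2 \<le> Re (cinner (Q x) x)"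
    and R: "\<And>y. Q (R y) = y"
  shows "bounded_clinear R"
proof (rule bounded_clinearI)
  note inj = coercive_injective[OF Q \<open>0 < d\<close> coercive]
  show "R (x + y) = R x + R y" for x y
    by (rule inj) (simp add: R bounded_clinear_add[OF Q])
  show "R (c *\<^sub>C x) = c *\<^sub>C R x" for c x
    by (rule inj) (simp add: R bounded_clinear_scaleC[OF Q])
  show "norm (R x) \<le> norm x * (1 / d)" for x
    using coercive_norm_le[of d Q "R x", OF \<open>0 < d\<close> coercive] \<open>0 < d\<close> by (simp add: R field_simps)
qed

text \<open>By the resolvent identity, the difference quotient of \<open>R z y\<close> is a finite
  sum in which only the scalars \<open>\<alpha> i\<close> are differentiated, while
  \<open>R z\<close> acts on the fixed vectors \<open>B i u\<close>. Pointwise continuity of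
  \<open>R\<close> then suffices for the limit, and matrix coefficients are all that the determinant
  uses.\<close>

lemma holomorphic_inverse_family:
  fixes Q :: "complex \<Rightarrow> 'a::complex_inner \<Rightarrow> 'a"
  assumes "finite I" and "open U"
    and B: "\<And>i. i \<in> I \<Longrightarrow> bounded_clinear (B i)"
    and \<alpha>: "\<And>i. i \<in> I \<Longrightarrow> \<alpha> i holomorphic_on U"
    and Q: "\<And>z x. Q z x = (\<Sum>i\<in>I. \<alpha> i z *\<^sub>C B i x)"
    and "0 < d" and coercive: "\<And>z x. z \<in> U \<Longrightarrow> d * (norm x)\<^sup>2 \<le> Re (cinner (Q z x) x)"
    and R: "\<And>z y. z \<in> U \<Longrightarrow> Q z (R z y) = y"
  shows "(\<lambda>z. cinner (R z y) w) holomorphic_on U"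
proof -
  have Q_lin: "bounded_clinear (Q z)" for z
    using bounded_clinear_sum[of I B "\<lambda>i. \<alpha> i z", OF B] by (simp add: Q[abs_def])
  have R_lin: "bounded_clinear (R z)" if "z \<in> U" for z
    using inverse_bounded_clinear[OF Q_lin \<open>0 < d\<close> coercive[OF that] R[OF that]] .
  have \<alpha>_diff: "(\<alpha> i has_field_derivative deriv (\<alpha> i) z) (at z)" if "i \<in> I" "z \<in> U" for i z
    using \<alpha>[OF that(1)] \<open>open U\<close> that(2) by (simp add: holomorphic_derivI)
  have \<alpha>_cont: "(\<alpha> i \<longlongrightarrow> \<alpha> i z) (at z)" if "i \<in> I" "z \<in> U" for i z
    using DERIV_isCont[OF \<alpha>_diff[OF that]] by (simp add: isCont_def)
  have R_cont: "((\<lambda>z. R z v) \<longlongrightarrow> R z0 v) (at z0)" if z0: "z0 \<in> U" for z0 v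
  proof -
    define u where "u = R z0 v"
    have "((\<lambda>z. Q z u) \<longlongrightarrow> Q z0 u) (at z0)"
      unfolding Q by (intro tendsto_sum tendsto_scaleC tendsto_const \<alpha>_cont z0)
    then have "((\<lambda>z. norm (Q z u - v) / d) \<longlongrightarrow> norm (Q z0 u - v) / d) (at z0)"
      using \<open>0 < d\<close> by (intro tendsto_intros) auto
    then have lim: "((\<lambda>z. norm (Q z u - v) / d) \<longlongrightarrow> 0) (at z0)"
      unfolding u_def R[OF z0] by simp
    \<comment> \<open>Coercivity, uniform in \<open>z\<close>, turns the residual of the fixed
      vector \<open>u\<close> in the equation at \<open>z\<close> into a bound for the
      error.\<close>
    have "norm (R z v - u) \<le> norm (Q z u - v) / d" if "z \<in> U" for z
      using coercive_norm_le[of d "Q z" "R z v - u", OF \<open>0 < d\<close> coercive[OF that]] \<open>0 < d\<close>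
      by (simp add: bounded_clinear_diff[OF Q_lin] R[OF that] field_simps norm_minus_commute)
    then have "\<forall>\<^sub>F z in at z0. norm (R z v - u) \<le> norm (Q z u - v) / d"
      using eventually_at_in_open'[OF \<open>open U\<close> z0] by (auto elim: eventually_mono)
    then have "((\<lambda>z. R z v - u) \<longlongrightarrow> 0) (at z0)"
      using lim by (rule Lim_null_comparison)
    then show ?thesis
      unfolding u_def by (simp add: LIM_zero_iff)
  qed
  have "\<exists>D. ((\<lambda>z. cinner (R z y) w) has_field_derivative D) (at z0)" if z0: "z0 \<in> U" for z0
  proof -
    define u where "u = R z0 y"
    define g where "g z = - (\<Sum>i\<in>I. (\<alpha> i z - \<alpha> i z0) / (z - z0) * cinner (R z (B i u)) w)" for z
    have g_eq: "(cinner (R z y) w - cinner (R z0 y) w) / (z - z0) = g z" if "z \<in> U" for z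
    proof -
      have "Q z0 u - Q z u = - (\<Sum>i\<in>I. (\<alpha> i z - \<alpha> i z0) *\<^sub>C B i u)"
        unfolding Q by (simp add: scaleC_diff_left sum_subtractf)
      moreover have "Q z0 u = y"
        by (simp add: u_def R[OF z0])
      ultimately have "Q z (R z y - u) = - (\<Sum>i\<in>I. (\<alpha> i z - \<alpha> i z0) *\<^sub>C B i u)"
        by (simp add: bounded_clinear_diff[OF Q_lin] R[OF that])
      also have "\<dots> = Q z (- (\<Sum>i\<in>I. (\<alpha> i z - \<alpha> i z0) *\<^sub>C R z (B i u)))"
        using bounded_clinear_bounded_linear[OF Q_lin[of z]]
        by (simp add: linear_simps linear_sum[OF bounded_linear.linear] bounded_clinear_scaleC[OF Q_lin] R[OF that])
      finally have "R z y - u = - (\<Sum>i\<in>I. (\<alpha> i z - \<alpha> i z0) *\<^sub>C R z (B i u))"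
        by (rule coercive_injective[OF Q_lin \<open>0 < d\<close> coercive[OF that]])
      then have "cinner (R z y) w - cinner u w = - (\<Sum>i\<in>I. (\<alpha> i z - \<alpha> i z0) * cinner (R z (B i u)) w)"
        unfolding cinner_diff_left[symmetric]
        by (simp add: cinner_minus_left cinner_sum_left cinner_scaleC_left)
      then show ?thesis
        unfolding g_def u_def[symmetric] by (simp add: sum_divide_distrib)
    qed
    have "(g \<longlongrightarrow> - (\<Sum>i\<in>I. deriv (\<alpha> i) z0 * cinner (R z0 (B i u)) w)) (at z0)"
      unfolding g_def using \<alpha>_diff[OF _ z0]
      by (intro tendsto_minus tendsto_sum tendsto_mult tendsto_cinner R_cont z0 tendsto_const)
        (auto simp: has_field_derivative_iff)
    moreover have "\<forall>\<^sub>F z in at z0. g z = (cinner (R z y) w - cinner (R z0 y) w) / (z - z0)"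
      using eventually_at_in_open'[OF \<open>open U\<close> z0] g_eq by (auto elim: eventually_mono)
    ultimately show ?thesis
      unfolding has_field_derivative_iff by (blast intro: Lim_transform_eventually)
  qed
  then show ?thesis
    using \<open>open U\<close> by (simp add: holomorphic_on_open)
qed

lemma holomorphic_on_det:
  fixes m :: "nat \<Rightarrow> nat \<Rightarrow> complex \<Rightarrow> complex"
  assumes "\<And>i j. i < n \<Longrightarrow> j < n \<Longrightarrow> m i j holomorphic_on U"
  shows "(\<lambda>z. Determinant.det (mat n n (\<lambda>(i, j). m i j z))) holomorphic_on U"
proof -
  have "Determinant.det (mat n n (\<lambda>(i, j). m i j z)) =
      (\<Sum>p | p permutes {0..<n}. signof p * (\<Prod>i = 0..<n. m i (p i) z))" for z
  proof -
    have "p i < n" if "p permutes {0..<n}" "i < n" for p i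
      using permutes_in_image[OF that(1), of i] that(2) by simp
    then show ?thesis
      by (subst det_def'[of _ n]) (auto intro!: sum.cong prod.cong)
  qed
  moreover have "(\<lambda>z. \<Sum>p | p permutes {0..<n}. signof p * (\<Prod>i = 0..<n. m i (p i) z)) holomorphic_on U"
  proof (intro holomorphic_intros)
    show "m i (p i) holomorphic_on U" if "p \<in> {p. p permutes {0..<n}}" "i \<in> {0..<n}" for p i
      using permutes_in_image[of p "{0..<n}" i] that by (intro assms) auto
  qed
  ultimately show ?thesis
    by simp
qed

text \<open>If \<open>P = Q - projection_onto f {..<n}\<close> and \<open>Q\<close> has inverse \<open>R\<close>, then \<open>P x = 0\<close> says that
  \<open>x\<close> is the image under \<open>R\<close> of its own projection, an equation in the \<open>n\<close> coordinates of \<open>x\<close>.\<close>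

lemma kernel_iff_det_zero:
  fixes f :: "nat \<Rightarrow> 'a::complex_inner"
  assumes Q: "bounded_clinear Q" and inj: "\<And>x y. Q x = Q y \<Longrightarrow> x = y" and R: "\<And>y. Q (R y) = y"
  shows "(\<exists>x. x \<noteq> 0 \<and> Q x = projection_onto f {..<n} x) \<longleftrightarrow>
    Determinant.det (mat n n (\<lambda>(i, j). (if i = j then 1 else 0) - cinner (R (f j)) (f i))) = 0"
proof -
  define M where "M = mat n n (\<lambda>(i, j). (if i = j then 1 else 0) - cinner (R (f j)) (f i))"
  \<comment> \<open>\<open>T c\<close> solves the equation \<open>Q x = y\<close> for the right-hand
    side with coefficients \<open>c\<close>. The matrix \<open>M\<close> subtracts from
    \<open>v\<close> the coordinates of the solution built from \<open>v\<close>, so its null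
    vectors are those reproduced by this process.\<close>
  define T where "T c = (\<Sum>j<n. c j *\<^sub>C R (f j))" for c
  have M: "M \<in> carrier_mat n n"
    by (simp add: M_def)
  have QT: "Q (T c) = (\<Sum>j<n. c j *\<^sub>C f j)" for c
    using bounded_clinear_bounded_linear[OF Q]
    by (simp add: T_def linear_sum[OF bounded_linear.linear] bounded_clinear_scaleC[OF Q] R)
  have Mv: "(M *\<^sub>v v) $ i = v $ i - cinner (T (\<lambda>j. v $ j)) (f i)" if v: "v \<in> carrier_vec n" and i: "i < n" for v i
  proof -
    have "(M *\<^sub>v v) $ i = (\<Sum>j = 0..<n. ((if i = j then 1 else 0) - cinner (R (f j)) (f i)) * v $ j)"
      using v i by (simp add: M_def scalar_prod_def)
    also have "\<dots> = (\<Sum>j = 0..<n. if i = j then v $ j else 0) - (\<Sum>j = 0..<n. cinner (R (f j)) (f i) * v $ j)"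
      unfolding sum_subtractf[symmetric] by (intro sum.cong) (auto simp: algebra_simps)
    also have "\<dots> = v $ i - cinner (T (\<lambda>j. v $ j)) (f i)"
      using i by (simp add: T_def cinner_sum_left cinner_scaleC_left atLeast0LessThan mult.commute)
    finally show ?thesis .
  qed
  have "(\<exists>x. x \<noteq> 0 \<and> Q x = projection_onto f {..<n} x) \<longleftrightarrow>
      (\<exists>v. v \<in> carrier_vec n \<and> v \<noteq> 0\<^sub>v n \<and> M *\<^sub>v v = 0\<^sub>v n)"
  proof
    assume "\<exists>x. x \<noteq> 0 \<and> Q x = projection_onto f {..<n} x"
    then obtain x where x: "x \<noteq> 0" "Q x = projection_onto f {..<n} x"
      by blast
    define v where "v = vec n (\<lambda>j. cinner x (f j))"
    have v: "v \<in> carrier_vec n"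
      by (simp add: v_def)
    have "T (\<lambda>j. v $ j) = x"
      by (rule inj) (simp add: QT x(2) projection_onto_def v_def)
    moreover have "v \<noteq> 0\<^sub>v n"
    proof
      assume "v = 0\<^sub>v n"
      then have "T (\<lambda>j. v $ j) = 0"
        by (simp add: T_def scaleC_zero_left)
      then show False
        using calculation x(1) by simp
    qed
    moreover have "M *\<^sub>v v = 0\<^sub>v n"
      using M Mv[OF v] calculation(1) by (intro eq_vecI) (auto simp: v_def)
    ultimately show "\<exists>v. v \<in> carrier_vec n \<and> v \<noteq> 0\<^sub>v n \<and> M *\<^sub>v v = 0\<^sub>v n"
      using v by blast
  next
    assume "\<exists>v. v \<in> carrier_vec n \<and> v \<noteq> 0\<^sub>v n \<and> M *\<^sub>v v = 0\<^sub>v n"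
    then obtain v where v: "v \<in> carrier_vec n" "v \<noteq> 0\<^sub>v n" "M *\<^sub>v v = 0\<^sub>v n"
      by blast
    define x where "x = T (\<lambda>j. v $ j)"
    have coord: "cinner x (f i) = v $ i" if "i < n" for i
      using Mv[OF v(1) that] that by (simp add: v(3) x_def)
    have "Q x = projection_onto f {..<n} x"
      unfolding projection_onto_def using coord by (simp add: x_def QT)
    moreover have "x \<noteq> 0"
    proof
      assume "x = 0"
      then have "v = 0\<^sub>v n"
        using coord v(1) by (intro eq_vecI) (auto simp: cinner_zero_left)
      then show False
        using v(2) by simp
    qed
    ultimately show "\<exists>x. x \<noteq> 0 \<and> Q x = projection_onto f {..<n} x"
      by blast
  qed
  then show ?thesis
    using det_0_iff_vec_prod_zero_field[OF M] by (simp add: M_def)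
qed


subsection \<open>Analytic curves\<close>

lemma islimpt_Int_open:
  assumes "x islimpt S" and "open U" and "x \<in> U"
  shows "x islimpt S \<inter> U"
  using assms by (intro islimpt_Int_eventually) (auto intro: eventually_at_in_open')

text \<open>The set of limit points of \<open>S\<close> in the interval is nonempty by
  Bolzano-Weierstrass, always closed, and open by the local hypothesis; so it is the whole interval,
  and the local hypothesis puts each of its points into \<open>S\<close>. The scheme serves zeros of
  heights as well as contact parameters.\<close>

lemma infinite_subset_propagates:
  fixes S :: "real set"
  assumes "S \<subseteq> {a..b}" and "infinite S"
    and step: "\<And>t0. t0 \<in> {a..b} \<Longrightarrow> t0 islimpt S \<Longrightarrow> \<exists>e>0. \<forall>t\<in>{a..b}. \<bar>t - t0\<bar> < e \<longrightarrow> t \<in> S"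
  shows "{a..b} \<subseteq> S"
proof -
  define L where "L = {t \<in> {a..b}. t islimpt S}"
  obtain l where "l \<in> L"
    unfolding L_def using Heine_Borel_imp_Bolzano_Weierstrass[OF compact_Icc assms(2,1)] by blast
  have "a < b"
    using infinite_super[OF assms(1,2)] by simp
  have nbhd: "\<exists>e>0. {a..b} \<inter> ball t0 e \<subseteq> S" if t0: "t0 \<in> L" for t0
  proof -
    obtain e where "0 < e" "\<And>t. t \<in> {a..b} \<Longrightarrow> \<bar>t - t0\<bar> < e \<Longrightarrow> t \<in> S"
      using step[of t0] t0 unfolding L_def by blast
    then show ?thesis
      by (intro exI[of _ e]) (auto simp: dist_real_def abs_minus_commute)
  qed
  have "openin (top_of_set {a..b}) L"
    unfolding openin_contains_ball
  proof (intro conjI ballI)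
    fix t0
    assume "t0 \<in> L"
    then obtain e where "0 < e" and e: "{a..b} \<inter> ball t0 e \<subseteq> S"
      using nbhd by blast
    have "t islimpt S" if "t \<in> ball t0 e \<inter> {a..b}" for t
    proof -
      \<comment> \<open>A nondegenerate interval has no isolated points, endpoints included, so a
        full relative neighbourhood in \<open>S\<close> consists of limit points of
        \<open>S\<close>.\<close>
      have "t islimpt {a..b}"
        using that \<open>a < b\<close> by (intro connected_imp_perfect) auto
      then have "t islimpt {a..b} \<inter> ball t0 e"
        using that by (intro islimpt_Int_open) auto
      then show ?thesis
        using e by (rule islimpt_subset)
    qed
    then show "\<exists>e>0. ball t0 e \<inter> {a..b} \<subseteq> L"
      using \<open>0 < e\<close> unfolding L_def by blast
  qed (auto simp: L_def)
  moreover have "L = {a..b} \<inter> {t. t islimpt S}"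
    by (auto simp: L_def)
  then have "closedin (top_of_set {a..b}) L"
    using closedin_closed_Int[OF closed_limpts[of S]] by simp
  ultimately have "L = {a..b}"
    using connected_Icc[of a b, unfolded connected_clopen, rule_format, of L] \<open>l \<in> L\<close> by auto
  show ?thesis
  proof
    fix t
    assume "t \<in> {a..b}"
    then obtain e where "0 < e" "{a..b} \<inter> ball t e \<subseteq> S"
      using nbhd \<open>L = {a..b}\<close> by blast
    then show "t \<in> S"
      using \<open>t \<in> {a..b}\<close> centre_in_ball[of t e] by blast
  qed
qed

section \<open>Holomorphic continuation from real parameters\<close>

lemma holomorphic_eq_zero_of_real_limpt:
  assumes "F holomorphic_on ball (of_real t0) e" and "0 < e" and "t0 islimpt S"
    and zero: "\<And>t. t \<in> S \<Longrightarrow> \<bar>t - t0\<bar> < e \<Longrightarrow> F (of_real t) = 0"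
    and "z \<in> ball (of_real t0) e"
  shows "F z = 0"
proof (rule analytic_continuation[of F _ "of_real ` (S \<inter> ball t0 e)" "of_real t0"])
  have "t0 islimpt S \<inter> ball t0 e"
    using assms(2,3) by (intro islimpt_Int_open) auto
  then obtain f where f: "\<And>n. f n \<in> S \<inter> ball t0 e - {t0}" "f \<longlonglongrightarrow> t0"
    unfolding islimpt_sequential by blast
  then show "complex_of_real t0 islimpt of_real ` (S \<inter> ball t0 e)"
    unfolding islimpt_sequential
    by (intro exI[of _ "\<lambda>n. of_real (f n)"]) (auto intro!: tendsto_of_real)
  show "of_real ` (S \<inter> ball t0 e) \<subseteq> ball (complex_of_real t0) e"
    by (auto simp: dist_of_real)
qed (use assms in \<open>auto simp: dist_real_def abs_minus_commute\<close>)

text \<open>Convergence at a single real point \<open>t1\<close> gives convergence in the open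
  complex disc through it. One point on one side of \<open>t0\<close> is therefore enough, which is
  what makes endpoints of the parameter interval accessible.\<close>

lemma power_series_holomorphic_extension:
  fixes h :: "real \<Rightarrow> complex"
  assumes "summable (\<lambda>n. (t1 - t0) ^ n *\<^sub>R c n)"
    and h: "\<And>t. t \<in> S \<Longrightarrow> \<bar>t - t0\<bar> < \<bar>t1 - t0\<bar> \<Longrightarrow> (\<lambda>n. (t - t0) ^ n *\<^sub>R c n) sums h t"
  obtains G where "G holomorphic_on ball (of_real t0) \<bar>t1 - t0\<bar>"
    and "\<And>t. t \<in> S \<Longrightarrow> \<bar>t - t0\<bar> < \<bar>t1 - t0\<bar> \<Longrightarrow> G (of_real t) = h t"
proof -
  define G where "G z = (\<Sum>n. c n * (z - of_real t0) ^ n)" for z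
  have *: "r ^ n *\<^sub>R c n = c n * of_real r ^ n" for r n
    by (simp add: scaleR_conv_of_real)
  have summable: "summable (\<lambda>n. c n * complex_of_real (t1 - t0) ^ n)"
    using assms(1) by (simp only: *)
  have "G holomorphic_on ball (of_real t0) \<bar>t1 - t0\<bar>"
  proof (rule power_series_holomorphic)
    fix w
    assume "w \<in> ball (complex_of_real t0) \<bar>t1 - t0\<bar>"
    then have "norm (w - of_real t0) < norm (complex_of_real (t1 - t0))"
      unfolding mem_ball dist_norm norm_of_real by (subst norm_minus_commute)
    then show "(\<lambda>n. c n * (w - of_real t0) ^ n) sums G w"
      unfolding G_def by (rule summable_sums[OF powser_inside[OF summable]])
  qed
  moreover have "G (of_real t) = h t" if "t \<in> S" "\<bar>t - t0\<bar> < \<bar>t1 - t0\<bar>" for t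
    using sums_unique[OF h[OF that]] by (simp only: * G_def of_real_diff)
  ultimately show ?thesis
    by (rule that)
qed

abbreviation velocity :: "(real \<Rightarrow> complex) \<Rightarrow> real \<Rightarrow> real \<Rightarrow> real \<Rightarrow> complex"
  where "velocity \<gamma> a b t \<equiv> vector_derivative \<gamma> (at t within {a..b})"

text \<open>\<open>Gs\<close> is the power series with conjugated coefficients: holomorphic, and
  equal to the conjugate of the curve at real parameters. \<open>G\<close> and \<open>Gs\<close>
  together continue every expression in the curve, its conjugate and their velocities.\<close>

lemma analytic_curve_extension:
  assumes "a < b" and "real_analytic_on \<gamma> {a..b}" and t0: "t0 \<in> {a..b}"
  obtains e G Gs where "0 < e" and "G holomorphic_on ball (of_real t0) e"
    and "Gs holomorphic_on ball (of_real t0) e"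
    and "\<And>t. t \<in> {a..b} \<Longrightarrow> \<bar>t - t0\<bar> < e \<Longrightarrow> G (of_real t) = \<gamma> t"
    and "\<And>t. t \<in> {a..b} \<Longrightarrow> \<bar>t - t0\<bar> < e \<Longrightarrow> Gs (of_real t) = cnj (\<gamma> t)"
    and "\<And>t. t \<in> {a..b} \<Longrightarrow> \<bar>t - t0\<bar> < e \<Longrightarrow> deriv G (of_real t) = velocity \<gamma> a b t"
    and "\<And>t. t \<in> {a..b} \<Longrightarrow> \<bar>t - t0\<bar> < e \<Longrightarrow> deriv Gs (of_real t) = cnj (velocity \<gamma> a b t)"
    and "\<And>t. t \<in> {a..b} \<Longrightarrow> \<bar>t - t0\<bar> < e \<Longrightarrow>
      (\<gamma> has_vector_derivative velocity \<gamma> a b t) (at t within {a..b})"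
proof -
  obtain e c where "0 < e"
    and c: "\<And>t. t \<in> {a..b} \<Longrightarrow> \<bar>t - t0\<bar> < e \<Longrightarrow> (\<lambda>n. (t - t0) ^ n *\<^sub>R c n) sums \<gamma> t"
    using assms(2) t0 unfolding real_analytic_on_def by metis
  \<comment> \<open>The auxiliary parameter is taken on a side of \<open>t0\<close> that lies in the
    interval; its distance to \<open>t0\<close> becomes the radius of the disc.\<close>
  have "\<exists>t1\<in>{a..b}. t1 \<noteq> t0 \<and> \<bar>t1 - t0\<bar> < e"
  proof (cases "t0 < b")
    case True
    then show ?thesis
      using t0 \<open>0 < e\<close> by (intro bexI[of _ "min b (t0 + e / 2)"]) (auto simp: min_def)
  next
    case False
    then show ?thesis
      using t0 \<open>0 < e\<close> \<open>a < b\<close> by (intro bexI[of _ "max a (t0 - e / 2)"]) (auto simp: max_def)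
  qed
  then obtain t1 where t1: "t1 \<in> {a..b}" "t1 \<noteq> t0" "\<bar>t1 - t0\<bar> < e"
    by blast
  define \<rho> where "\<rho> = \<bar>t1 - t0\<bar>"
  have "0 < \<rho>" "\<rho> < e"
    using t1 by (auto simp: \<rho>_def)
  have c_cnj: "(\<lambda>n. (t - t0) ^ n *\<^sub>R cnj (c n)) sums cnj (\<gamma> t)" if "t \<in> {a..b}" "\<bar>t - t0\<bar> < e" for t
    using c[OF that] by (subst (asm) sums_cnj[symmetric]) (simp add: scaleR_conv_of_real)
  obtain G where G: "G holomorphic_on ball (of_real t0) \<rho>"
    "\<And>t. t \<in> {a..b} \<Longrightarrow> \<bar>t - t0\<bar> < \<rho> \<Longrightarrow> G (of_real t) = \<gamma> t"
    using power_series_holomorphic_extension[OF sums_summable[OF c[OF t1(1,3)]], of "{a..b}" \<gamma>, OF c]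
      \<open>\<rho> < e\<close> unfolding \<rho>_def by auto
  obtain Gs where Gs: "Gs holomorphic_on ball (of_real t0) \<rho>"
    "\<And>t. t \<in> {a..b} \<Longrightarrow> \<bar>t - t0\<bar> < \<rho> \<Longrightarrow> Gs (of_real t) = cnj (\<gamma> t)"
    using power_series_holomorphic_extension[OF sums_summable[OF c_cnj[OF t1(1,3)]],
        of "{a..b}" "\<lambda>t. cnj (\<gamma> t)", OF c_cnj] \<open>\<rho> < e\<close> unfolding \<rho>_def by auto
  have deriv: "(h has_vector_derivative deriv F (of_real t)) (at t within {a..b})"
    if F: "F holomorphic_on ball (of_real t0) \<rho>"
      "\<And>t. t \<in> {a..b} \<Longrightarrow> \<bar>t - t0\<bar> < \<rho> \<Longrightarrow> F (of_real t) = h t"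
      and t: "t \<in> {a..b}" "\<bar>t - t0\<bar> < \<rho>" for F t and h :: "real \<Rightarrow> complex"
  proof -
    have "of_real t \<in> ball (complex_of_real t0) \<rho>"
      using t(2) by (simp add: dist_of_real dist_real_def abs_minus_commute)
    then have "(F has_field_derivative deriv F (of_real t)) (at (of_real t))"
      using F(1) by (intro holomorphic_derivI) auto
    then have "((\<lambda>t. F (of_real t)) has_vector_derivative deriv F (of_real t)) (at t within {a..b})"
      by (rule has_vector_derivative_real_field)
    then show ?thesis
    proof (rule has_vector_derivative_transform_within)
      show "0 < \<rho> - \<bar>t - t0\<bar>"
        using t by simp
    qed (use F(2) t in \<open>auto simp: dist_real_def\<close>)
  qed
  have vel: "velocity \<gamma> a b t = deriv G (of_real t)" if "t \<in> {a..b}" "\<bar>t - t0\<bar> < \<rho>" for t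
    using deriv[OF G that] that \<open>a < b\<close>
    by (intro vector_derivative_within_closed_interval[OF \<open>a < b\<close>]) auto
  show ?thesis
  proof (rule that[OF \<open>0 < \<rho>\<close> G(1) Gs(1)])
    fix t
    assume t: "t \<in> {a..b}" "\<bar>t - t0\<bar> < \<rho>"
    show "G (of_real t) = \<gamma> t" "Gs (of_real t) = cnj (\<gamma> t)"
      using t by (simp_all add: G(2) Gs(2))
    show "deriv G (of_real t) = velocity \<gamma> a b t"
      using vel[OF t] by simp
    show has: "(\<gamma> has_vector_derivative velocity \<gamma> a b t) (at t within {a..b})"
      using deriv[OF G t] vel[OF t] by simp
    show "deriv Gs (of_real t) = cnj (velocity \<gamma> a b t)"
      using vector_derivative_unique_within_closed_interval[of a b t, unfolded box_real, OF \<open>a < b\<close> t(1)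
          deriv[OF Gs t] has_vector_derivative_cnj[OF has]] .
  qed
qed

lemma analytic_curve_has_vector_derivative:
  assumes "a < b" and "real_analytic_on \<gamma> {a..b}" and "t \<in> {a..b}"
  shows "(\<gamma> has_vector_derivative velocity \<gamma> a b t) (at t within {a..b})"
  by (rule analytic_curve_extension[OF assms]) (use assms(3) in auto)

lemma analytic_curve_continuous:
  fixes \<gamma> :: "real \<Rightarrow> complex"
  assumes "a < b" and "real_analytic_on \<gamma> {a..b}"
  shows "continuous_on {a..b} \<gamma>"
  unfolding continuous_on_eq_continuous_within
  by (intro ballI has_vector_derivative_continuous[OF analytic_curve_has_vector_derivative[OF assms]])

lemma velocity_continuous:
  assumes "a < b" and "real_analytic_on \<gamma> {a..b}"
  shows "continuous_on {a..b} (velocity \<gamma> a b)"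
  unfolding continuous_on_eq_continuous_within
proof
  fix t0
  assume t0: "t0 \<in> {a..b}"
  obtain e G where "0 < e" and G: "G holomorphic_on ball (of_real t0) e"
    "\<And>t. t \<in> {a..b} \<Longrightarrow> \<bar>t - t0\<bar> < e \<Longrightarrow> deriv G (of_real t) = velocity \<gamma> a b t"
    using analytic_curve_extension[OF assms t0] by metis
  have "continuous_on (ball (of_real t0) e) (deriv G)"
    using holomorphic_deriv[OF G(1) open_ball] by (rule holomorphic_on_imp_continuous_on)
  then have "isCont (deriv G) (complex_of_real t0)"
    using \<open>0 < e\<close> by (simp add: continuous_on_eq_continuous_at)
  then have "continuous (at t0 within {a..b}) (\<lambda>t. deriv G (of_real t))"
    by (rule continuous_within_compose3) (rule continuous_of_real[OF continuous_ident])
  then show "continuous (at t0 within {a..b}) (velocity \<gamma> a b)"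
    using \<open>0 < e\<close> t0 by (rule continuous_transform_within) (simp add: G(2) dist_real_def)
qed

subsection \<open>Tangents of curves in the boundary of a convex set\<close>

text \<open>This is the planar cross product of \<open>d\<close> and \<open>z - g\<close>: the
  signed distance of \<open>z\<close> from the line through \<open>g\<close> in direction
  \<open>d\<close>, times \<open>norm d\<close>, positive to the left of \<open>d\<close>.\<close>

definition height :: "complex \<Rightarrow> complex \<Rightarrow> complex \<Rightarrow> real"
  where "height d g z = Im (cnj d * (z - g))"

lemma height_eq_0_iff:
  assumes "d \<noteq> 0"
  shows "height d g z = 0 \<longleftrightarrow> (\<exists>s. z = g + s *\<^sub>R d)"
proof
  assume h: "height d g z = 0"
  have n: "cnj d * d \<noteq> 0"
    using assms by simp
  have "cnj d * (z - g) = of_real (Re (cnj d * (z - g)))"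
    using h by (intro complex_eqI) (auto simp: height_def)
  moreover have "cnj d * d = of_real ((norm d)\<^sup>2)"
    by (metis complex_norm_square mult.commute)
  ultimately have "cnj d * (z - g) = cnj d * ((Re (cnj d * (z - g)) / (norm d)\<^sup>2) *\<^sub>R d)"
    using assms by (simp add: scaleR_conv_of_real mult.left_commute[of "cnj d"] del: of_real_power)
  then have "z - g = (Re (cnj d * (z - g)) / (norm d)\<^sup>2) *\<^sub>R d"
    using assms by (simp only: mult_left_cancel complex_cnj_zero_iff not_False_eq_True)
  then show "\<exists>s. z = g + s *\<^sub>R d"
    by (metis add.commute diff_add_cancel)
next
  assume "\<exists>s. z = g + s *\<^sub>R d"
  then show "height d g z = 0"
    by (auto simp: height_def)
qed

lemma height_zero_trans:
  assumes "d \<noteq> 0" and "Im (cnj d * u) = 0" and "Im (cnj d * v) = 0"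
  shows "Im (cnj u * v) = 0"
proof -
  \<comment> \<open>Imaginary part of the product of \<open>cnj (cnj d * u)\<close> and
    \<open>cnj d * v\<close>.\<close>
  have "(norm d)\<^sup>2 * Im (cnj u * v) = Re (cnj d * u) * Im (cnj d * v) - Im (cnj d * u) * Re (cnj d * v)"
    unfolding cmod_power2 by (simp add: algebra_simps power2_eq_square)
  then show ?thesis
    using assms by simp
qed

text \<open>A frontier point need not be a relative frontier point: if \<open>D\<close> has empty
  interior, even its relative interior consists of frontier points. In that case \<open>D\<close>
  lies in a hyperplane, whose normal serves.\<close>

lemma convex_frontier_supporting_hyperplane:
  fixes D :: "'a::euclidean_space set"
  assumes "convex D" and g: "g \<in> frontier D"
  obtains n where "n \<noteq> 0" and "\<And>y. y \<in> closure D \<Longrightarrow> n \<bullet> g \<le> n \<bullet> y"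
proof -
  have g': "g \<in> closure D" "g \<notin> interior D"
    using g by (simp_all add: frontier_def)
  show ?thesis
  proof (cases "g \<in> rel_interior D")
    case False
    show ?thesis
      by (rule supporting_hyperplane_relative_frontier[OF \<open>convex D\<close> g'(1) False]) (rule that)
  next
    case True
    then have "interior D = {}"
      using g'(2) rel_interior_nonempty_interior[of D] by metis
    then obtain n c where n: "n \<noteq> 0" "D \<subseteq> {x. n \<bullet> x = c}"
      by (rule empty_interior_subset_hyperplane[OF \<open>convex D\<close>])
    have "closure D \<subseteq> {x. n \<bullet> x = c}"
      by (rule closure_minimal[OF n(2) closed_hyperplane])
    then show ?thesis
      using n(1) g'(1) by (intro that[of n]) (simp_all add: subset_eq)
  qed
qed

text \<open>Stating that the tangent supports \<open>D\<close> as equality of the signs of any two heights avoids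
  orienting the curve and passes to the limit at the endpoints.\<close>

lemma tangent_supports_interior:
  assumes "convex D" and t: "t \<in> {a<..<b}" and curve: "\<gamma> ` {a..b} \<subseteq> frontier D"
    and d: "(\<gamma> has_vector_derivative d) (at t)" "d \<noteq> 0"
    and zw: "z \<in> closure D" "w \<in> closure D"
  shows "0 \<le> height d (\<gamma> t) z * height d (\<gamma> t) w"
proof -
  have "\<gamma> t \<in> frontier D"
    using t by (intro subsetD[OF curve] imageI) simp
  then obtain n where "n \<noteq> 0" and n: "\<And>y. y \<in> closure D \<Longrightarrow> n \<bullet> \<gamma> t \<le> n \<bullet> y"
    using convex_frontier_supporting_hyperplane[OF \<open>convex D\<close>] by blast
  have "((\<lambda>s. n \<bullet> \<gamma> s) has_real_derivative n \<bullet> d) (at t)"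
    using bounded_linear.has_vector_derivative[OF bounded_linear_inner_right d(1)]
    by (simp add: has_real_derivative_iff_has_vector_derivative)
  moreover have "0 < min (t - a) (b - t)"
    using t by simp
  moreover have "\<forall>s. \<bar>t - s\<bar> < min (t - a) (b - t) \<longrightarrow> n \<bullet> \<gamma> t \<le> n \<bullet> \<gamma> s"
  proof (intro allI impI n)
    fix s
    assume "\<bar>t - s\<bar> < min (t - a) (b - t)"
    then have "\<gamma> s \<in> frontier D"
      by (intro subsetD[OF curve] imageI) (simp add: abs_less_iff)
    then show "\<gamma> s \<in> closure D"
      by (simp add: frontier_def)
  qed
  ultimately have nd: "n \<bullet> d = 0"
    by (rule DERIV_local_min)
  \<comment> \<open>Being orthogonal to \<open>d\<close>, the normal \<open>n\<close> is a real
    multiple of \<open>\<i> * d\<close>, so its inner products are a fixed multiple of heights. The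
    sign of \<open>k\<close> cancels in the product of two heights.\<close>
  define k where "k = n \<bullet> (\<i> * d)"
  have k: "(norm d)\<^sup>2 * (n \<bullet> v) = k * Im (cnj d * v)" for v
  proof -
    have "(norm d)\<^sup>2 * (n \<bullet> v) = (n \<bullet> d) * (d \<bullet> v) + k * Im (cnj d * v)"
      unfolding cmod_power2 k_def inner_complex_def by (simp add: algebra_simps power2_eq_square)
    then show ?thesis
      by (simp add: nd)
  qed
  have "k \<noteq> 0"
  proof
    assume "k = 0"
    then have "(norm d)\<^sup>2 * (n \<bullet> n) = 0"
      using k[of n] by simp
    then show False
      using \<open>n \<noteq> 0\<close> \<open>d \<noteq> 0\<close> by simp
  qed
  have nonneg: "0 \<le> k * height d (\<gamma> t) y" if "y \<in> closure D" for y
  proof -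
    have "k * height d (\<gamma> t) y = (norm d)\<^sup>2 * (n \<bullet> (y - \<gamma> t))"
      unfolding height_def k by (rule refl)
    then show ?thesis
      using n[OF that] by (simp add: inner_diff_right)
  qed
  have "0 \<le> (k * height d (\<gamma> t) z) * (k * height d (\<gamma> t) w)"
    by (rule mult_nonneg_nonneg[OF nonneg[OF zw(1)] nonneg[OF zw(2)]])
  also have "\<dots> = k\<^sup>2 * (height d (\<gamma> t) z * height d (\<gamma> t) w)"
    by (simp add: power2_eq_square)
  finally show ?thesis
    using \<open>k \<noteq> 0\<close> by (simp add: zero_le_mult_iff)
qed

text \<open>At an endpoint a one-sided minimum does not force the derivative to vanish, so the
  inequality there is obtained as a limit, by continuity of curve and velocity.\<close>

lemma tangent_supports:
  assumes "convex D" and curve: "compact_regular_analytic_curve \<gamma> a b" "\<gamma> ` {a..b} \<subseteq> frontier D"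
    and t: "t \<in> {a..b}" and zw: "z \<in> closure D" "w \<in> closure D"
  shows "0 \<le> height (velocity \<gamma> a b t) (\<gamma> t) z * height (velocity \<gamma> a b t) (\<gamma> t) w"
proof -
  have "a < b" and an: "real_analytic_on \<gamma> {a..b}"
    and reg: "\<And>t. t \<in> {a..b} \<Longrightarrow> velocity \<gamma> a b t \<noteq> 0"
    using curve(1) by (auto simp: compact_regular_analytic_curve_def)
  have cl: "closure {a<..<b} = {a..b}"
    using \<open>a < b\<close> by simp
  show ?thesis
  proof (rule continuous_ge_on_closure[where S = "{a<..<b}" and x = t and
        f = "\<lambda>t. height (velocity \<gamma> a b t) (\<gamma> t) z * height (velocity \<gamma> a b t) (\<gamma> t) w"])
    show "continuous_on (closure {a<..<b})
        (\<lambda>t. height (velocity \<gamma> a b t) (\<gamma> t) z * height (velocity \<gamma> a b t) (\<gamma> t) w)"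
      unfolding cl height_def
      by (intro continuous_intros velocity_continuous[OF \<open>a < b\<close> an] analytic_curve_continuous[OF \<open>a < b\<close> an])
    show "t \<in> closure {a<..<b}"
      using t cl by simp
    fix s
    assume s: "s \<in> {a<..<b}"
    have "(\<gamma> has_vector_derivative velocity \<gamma> a b s) (at s within {a..b})"
      using s by (intro analytic_curve_has_vector_derivative[OF \<open>a < b\<close> an]) auto
    moreover have "at s within {a..b} = at s"
      using s by (intro at_within_interior) (simp add: interior_atLeastAtMost_real)
    ultimately have "(\<gamma> has_vector_derivative velocity \<gamma> a b s) (at s)"
      by simp
    then show "0 \<le> height (velocity \<gamma> a b s) (\<gamma> s) z * height (velocity \<gamma> a b s) (\<gamma> s) w"
      using s reg[of s] by (intro tangent_supports_interior[OF \<open>convex D\<close> _ curve(2)] zw) auto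
  qed
qed


text \<open>In the real coordinate \<open>r\<close> along the line the curve is a continuous
  function on a compact interval, so it sweeps out a compact interval of the line.\<close>

lemma curve_in_line_is_segment:
  fixes a b :: real
  assumes "a < b" and "continuous_on {a..b} \<gamma>" and "d \<noteq> 0"
    and line: "\<And>t. t \<in> {a..b} \<Longrightarrow> height d g (\<gamma> t) = 0"
  shows "\<exists>p q. \<gamma> ` {a..b} = closed_segment p q"
proof -
  define r where "r t = Re (cnj d * (\<gamma> t - g)) / (norm d)\<^sup>2" for t
  have \<gamma>_eq: "\<gamma> t = g + r t *\<^sub>R d" if t: "t \<in> {a..b}" for t
  proof -
    obtain s where s: "\<gamma> t = g + s *\<^sub>R d"
      using line[OF t] height_eq_0_iff[OF \<open>d \<noteq> 0\<close>] by blast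
    have "Re (cnj d * (s *\<^sub>R d)) = s * (norm d)\<^sup>2"
      unfolding cmod_power2 by (simp add: algebra_simps power2_eq_square)
    then have "r t = s * (norm d)\<^sup>2 / (norm d)\<^sup>2"
      unfolding r_def s add_diff_cancel_left' by (rule arg_cong)
    then have "r t = s"
      using \<open>d \<noteq> 0\<close> by simp
    then show ?thesis
      using s by simp
  qed
  have "continuous_on {a..b} r"
    unfolding r_def using assms(2) \<open>d \<noteq> 0\<close> by (intro continuous_intros) auto
  then obtain m M where "r ` {a..b} = {m..M}" "m \<le> M"
    using continuous_image_closed_interval[of a b r] \<open>a < b\<close> by auto
  then have r: "r ` {a..b} = closed_segment m M"
    by (simp add: closed_segment_eq_real_ivl)
  have "\<gamma> ` {a..b} = (\<lambda>s. g + s *\<^sub>R d) ` r ` {a..b}"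
    unfolding image_image using \<gamma>_eq by (intro image_cong refl)
  also have "\<dots> = (\<lambda>z. g + z) ` (\<lambda>s. s *\<^sub>R d) ` closed_segment m M"
    unfolding r image_image by (rule refl)
  also have "\<dots> = closed_segment (g + m *\<^sub>R d) (g + M *\<^sub>R d)"
    unfolding closed_segment_translation
    by (subst closed_segment_linear_image[symmetric]) (simp_all add: linear_scale_left)
  finally show ?thesis
    by blast
qed

lemma analytic_curve_in_line:
  assumes "a < b" and an: "real_analytic_on \<gamma> {a..b}"
    and "infinite S" and S: "S \<subseteq> {t \<in> {a..b}. height d g (\<gamma> t) = 0}"
    and t: "t \<in> {a..b}"
  shows "height d g (\<gamma> t) = 0"
proof -
  define Z where "Z = {t \<in> {a..b}. height d g (\<gamma> t) = 0}"
  have "{a..b} \<subseteq> Z"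
  proof (rule infinite_subset_propagates)
    show "infinite Z"
      using infinite_super[OF S \<open>infinite S\<close>] by (simp add: Z_def)
    fix t0
    assume t0: "t0 \<in> {a..b}" "t0 islimpt Z"
    obtain e G Gs where "0 < e" and G: "G holomorphic_on ball (of_real t0) e"
      and Gs: "Gs holomorphic_on ball (of_real t0) e"
      and eq: "\<And>t. t \<in> {a..b} \<Longrightarrow> \<bar>t - t0\<bar> < e \<Longrightarrow> G (of_real t) = \<gamma> t"
        "\<And>t. t \<in> {a..b} \<Longrightarrow> \<bar>t - t0\<bar> < e \<Longrightarrow> Gs (of_real t) = cnj (\<gamma> t)"
      by (rule analytic_curve_extension[OF \<open>a < b\<close> an t0(1)]) blast
    \<comment> \<open>The height is an imaginary part and not itself holomorphic; writing
      \<open>2 * \<i>\<close> times it as a difference of conjugates lets both terms be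
      continued.\<close>
    define F where "F z = cnj d * (G z - g) - d * (Gs z - cnj g)" for z
    have F: "F (of_real t) = 2 * \<i> * of_real (height d g (\<gamma> t))" if "t \<in> {a..b}" "\<bar>t - t0\<bar> < e" for t
    proof -
      have "F (of_real t) = cnj d * (\<gamma> t - g) - cnj (cnj d * (\<gamma> t - g))"
        unfolding F_def eq[OF that] by simp
      also have "\<dots> = 2 * \<i> * of_real (height d g (\<gamma> t))"
        unfolding height_def by (intro complex_eqI) (simp_all add: algebra_simps)
      finally show ?thesis .
    qed
    have hol: "F holomorphic_on ball (of_real t0) e"
      unfolding F_def by (intro holomorphic_intros G Gs)
    have "t \<in> Z" if t: "t \<in> {a..b}" "\<bar>t - t0\<bar> < e" for t
    proof -
      have "F (of_real t) = 0"
      proof (rule holomorphic_eq_zero_of_real_limpt[OF hol \<open>0 < e\<close> t0(2)])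
        show "F (of_real s) = 0" if "s \<in> Z" "\<bar>s - t0\<bar> < e" for s
          using that F[of s] by (simp add: Z_def)
        show "of_real t \<in> ball (complex_of_real t0) e"
          using t(2) by (simp add: dist_of_real dist_real_def abs_minus_commute)
      qed
      then show ?thesis
        using F[OF t] t(1) by (simp add: Z_def)
    qed
    then show "\<exists>e>0. \<forall>t\<in>{a..b}. \<bar>t - t0\<bar> < e \<longrightarrow> t \<in> Z"
      using \<open>0 < e\<close> by blast
  qed (auto simp: Z_def)
  then show ?thesis
    using t by (auto simp: Z_def)
qed

text \<open>Multiplying the relation by one of the numbers turns it into a vanishing sum of
  nonnegative terms that contains a positive multiple of its square. The numbers will be the heights
  of the vertices of a triangle over a supporting line through an inner point.\<close>

lemma triangle_equal_heights:
  fixes x y z :: real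
  assumes "0 < p" "0 < q" "0 < r" and "p * x + q * y + r * z = 0"
    and "0 \<le> x * y" "0 \<le> x * z" "0 \<le> y * z"
  shows "x = 0 \<and> y = 0 \<and> z = 0"
proof -
  have *: "u = 0" if "0 < p" "0 < q" "0 < r" "p * u + q * v + r * w = 0" "0 \<le> u * v" "0 \<le> u * w"
    for p q r u v w :: real
  proof -
    have "p * (u * u) + q * (u * v) + r * (u * w) = u * (p * u + q * v + r * w)"
      by (simp add: algebra_simps)
    also have "\<dots> = 0"
      using that by simp
    moreover have "0 \<le> q * (u * v)" "0 \<le> r * (u * w)" "0 \<le> p * (u * u)"
      using that by simp_all
    ultimately have "p * (u * u) = 0"
      by linarith
    then show ?thesis
      using that by simp
  qed
  have "x = 0"
    by (rule *[of p q r x y z]) (use assms in auto)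
  moreover have "y = 0"
    by (rule *[of q p r y x z]) (use assms in \<open>auto simp: mult.commute\<close>)
  moreover have "z = 0"
    by (rule *[of r p q z x y]) (use assms in \<open>auto simp: mult.commute\<close>)
  ultimately show ?thesis
    by simp
qed

text \<open>Suppose a tangent at an interior parameter meets \<open>closure D\<close> at a second point \<open>p\<close>, and let
  \<open>q \<in> closure D\<close> lie off that tangent. Nearby points of the curve on the side of \<open>p\<close> have nonnegative
  barycentric coordinates in the triangle of \<open>\<gamma> t\<close>, \<open>p\<close>, \<open>q\<close>, and, being boundary points, cannot have
  three positive ones. Hence the curve runs along the tangent there, and everywhere by analyticity.\<close>

lemma tangent_meets_only_at_contact:
  assumes "convex D" and curve: "compact_regular_analytic_curve \<gamma> a b" "\<gamma> ` {a..b} \<subseteq> frontier D"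
    and t: "t \<in> {a<..<b}" and p: "p \<in> closure D" "height (velocity \<gamma> a b t) (\<gamma> t) p = 0"
    and not_segment: "\<not> (\<exists>p q. \<gamma> ` {a..b} = closed_segment p q)"
  shows "p = \<gamma> t"
proof (rule ccontr)
  assume "p \<noteq> \<gamma> t"
  have "a < b" and an: "real_analytic_on \<gamma> {a..b}"
    and reg: "\<And>t. t \<in> {a..b} \<Longrightarrow> velocity \<gamma> a b t \<noteq> 0"
    using curve(1) by (auto simp: compact_regular_analytic_curve_def)
  note supports = tangent_supports[OF \<open>convex D\<close> curve]
  have in_closure: "\<gamma> s \<in> closure D" if "s \<in> {a..b}" for s
    using subsetD[OF curve(2) imageI[OF that]] by (simp add: frontier_def)
  define d where "d = velocity \<gamma> a b t"
  define g where "g = \<gamma> t"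
  define h where "h = height d g"
  have t': "t \<in> {a..b}"
    using t by simp
  have "d \<noteq> 0"
    using reg[OF t'] by (simp add: d_def)
  \<comment> \<open>The third vertex \<open>q\<close> is found on the curve itself, since a curve
    inside the tangent line would be a segment.\<close>
  have not_line: "\<exists>s\<in>{a..b}. h (\<gamma> s) \<noteq> 0"
    using curve_in_line_is_segment[OF \<open>a < b\<close> analytic_curve_continuous[OF \<open>a < b\<close> an] \<open>d \<noteq> 0\<close>, of g]
      not_segment unfolding h_def by blast
  then obtain q where q: "q \<in> closure D" "h q \<noteq> 0"
    using in_closure by blast
  obtain s where s: "p = g + s *\<^sub>R d"
    using p(2) height_eq_0_iff[OF \<open>d \<noteq> 0\<close>, of g p] unfolding d_def g_def by blast
  have "s \<noteq> 0"
    using s \<open>p \<noteq> \<gamma> t\<close> by (auto simp: g_def)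
  define w where "w = q - g"
  define W where "W = Im (cnj d * w)"
  have "W \<noteq> 0"
    using q(2) by (simp add: W_def w_def h_def height_def)
  \<comment> \<open>Cramer's rule for the coordinates of \<open>\<gamma> u - g\<close> in the basis
    \<open>d\<close>, \<open>w\<close>. As \<open>p - g\<close> is \<open>s\<close> times
    \<open>d\<close>, the barycentric weights of \<open>p\<close> and \<open>q\<close> are
    \<open>\<alpha>s u / s\<close> and \<open>\<beta> u\<close>.\<close>
  define \<beta> where "\<beta> u = h (\<gamma> u) / W" for u
  define \<alpha>s where "\<alpha>s u = - Im (cnj w * (\<gamma> u - g)) / W" for u
  have \<beta>_nonneg: "0 \<le> \<beta> u" if "u \<in> {a..b}" for u
  proof -
    have "0 \<le> h (\<gamma> u) * W"
      using supports[OF t' in_closure[OF that] q(1)]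
      by (simp add: h_def d_def g_def W_def w_def height_def)
    then show ?thesis
      unfolding \<beta>_def by (simp add: zero_le_divide_iff zero_le_mult_iff)
  qed
  have decomp: "\<gamma> u - g = \<alpha>s u *\<^sub>R d + \<beta> u *\<^sub>R w" for u
  proof -
    have "W *\<^sub>R (\<gamma> u - g) = (- Im (cnj w * (\<gamma> u - g))) *\<^sub>R d + Im (cnj d * (\<gamma> u - g)) *\<^sub>R w"
      unfolding W_def by (intro complex_eqI) (simp_all add: algebra_simps)
    then have "(1 / W) *\<^sub>R (W *\<^sub>R (\<gamma> u - g)) =
        (1 / W) *\<^sub>R ((- Im (cnj w * (\<gamma> u - g))) *\<^sub>R d + Im (cnj d * (\<gamma> u - g)) *\<^sub>R w)"
      by (rule arg_cong)
    moreover have "(1 / W) *\<^sub>R (W *\<^sub>R (\<gamma> u - g)) = \<gamma> u - g"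
      using \<open>W \<noteq> 0\<close> by simp
    moreover have "(1 / W) *\<^sub>R ((- Im (cnj w * (\<gamma> u - g))) *\<^sub>R d + Im (cnj d * (\<gamma> u - g)) *\<^sub>R w) =
        \<alpha>s u *\<^sub>R d + \<beta> u *\<^sub>R w"
      by (simp only: \<alpha>s_def \<beta>_def h_def height_def scaleR_add_right scaleR_scaleR divide_inverse mult_1_left mult.commute)
    ultimately show ?thesis
      by simp
  qed
  define E where "E = {u \<in> {a..b}. 0 < \<alpha>s u / s \<and> \<alpha>s u / s + \<beta> u < 1}"
  have on_tangent: "h (\<gamma> u) = 0" if u: "u \<in> E" for u
  \<comment> \<open>Off the tangent all three weights are positive. The supporting tangent at
    \<open>\<gamma> u\<close> would then contain all three vertices, which are not collinear because
    \<open>s * W\<close> is nonzero.\<close>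
  proof (rule ccontr)
    assume "h (\<gamma> u) \<noteq> 0"
    have uab: "u \<in> {a..b}"
      using u by (simp add: E_def)
    define x where "x = \<alpha>s u / s"
    have x: "0 < x" "0 < 1 - x - \<beta> u"
      using u by (auto simp: E_def x_def)
    have y: "0 < \<beta> u"
      using \<beta>_nonneg[OF uab] \<open>h (\<gamma> u) \<noteq> 0\<close> \<open>W \<noteq> 0\<close> by (simp add: \<beta>_def less_le)
    define d' where "d' = velocity \<gamma> a b u"
    define H where "H = height d' (\<gamma> u)"
    have eq: "\<gamma> u = g + x *\<^sub>R (p - g) + \<beta> u *\<^sub>R (q - g)"
    proof -
      have "x *\<^sub>R (p - g) = \<alpha>s u *\<^sub>R d"
        using \<open>s \<noteq> 0\<close> by (simp add: x_def s)
      then show ?thesis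
        using decomp[of u] unfolding w_def by (simp only: diff_eq_eq ac_simps)
    qed
    have affine: "(1 - x - \<beta> u) *\<^sub>R (g - v) + x *\<^sub>R (p - v) + \<beta> u *\<^sub>R (q - v) =
        g + x *\<^sub>R (p - g) + \<beta> u *\<^sub>R (q - g) - v" for v
      by (simp add: algebra_simps)
    have bary: "(1 - x - \<beta> u) *\<^sub>R (g - \<gamma> u) + x *\<^sub>R (p - \<gamma> u) + \<beta> u *\<^sub>R (q - \<gamma> u) = 0"
      unfolding affine using eq by (simp only: diff_self)
    have "(1 - x - \<beta> u) * H g + x * H p + \<beta> u * H q =
        Im (cnj d' * ((1 - x - \<beta> u) *\<^sub>R (g - \<gamma> u) + x *\<^sub>R (p - \<gamma> u) + \<beta> u *\<^sub>R (q - \<gamma> u)))"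
      unfolding H_def height_def distrib_left mult_scaleR_right by simp
    also have "\<dots> = 0"
      unfolding bary by simp
    finally have "(1 - x - \<beta> u) * H g + x * H p + \<beta> u * H q = 0" .
    then have zero: "H g = 0 \<and> H p = 0 \<and> H q = 0"
      using supports[OF uab] in_closure[OF t'] p(1) q(1)
      by (intro triangle_equal_heights[OF x(2) x(1) y]) (simp_all add: H_def d'_def g_def)
    have "d' \<noteq> 0"
      using reg[OF uab] by (simp add: d'_def)
    moreover have "Im (cnj d' * (p - g)) = H p - H g" "Im (cnj d' * w) = H q - H g"
      unfolding H_def height_def w_def right_diff_distrib by simp_all
    then have "Im (cnj d' * (p - g)) = 0" "Im (cnj d' * w) = 0"
      using zero by simp_all
    ultimately have "Im (cnj (p - g) * w) = 0"
      by (rule height_zero_trans)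
    also have "p - g = s *\<^sub>R d"
      by (simp add: s)
    also have "Im (cnj (s *\<^sub>R d) * w) = s * W"
      unfolding W_def complex_cnj_scaleR mult_scaleR_left by simp
    finally have "s * W = 0" .
    then show False
      using \<open>s \<noteq> 0\<close> \<open>W \<noteq> 0\<close> by simp
  qed
  \<comment> \<open>\<open>\<alpha>s\<close> vanishes at \<open>t\<close> with derivative 1, the
    velocity being \<open>d\<close> itself. So \<open>\<alpha>s u / s\<close> is positive just after
    \<open>t\<close> if \<open>s\<close> is positive and just before \<open>t\<close> otherwise; an
    interior parameter offers both sides.\<close>
  have "infinite E"
  proof -
    have der: "(\<gamma> has_vector_derivative d) (at t)"
    proof -
      have "at t within {a..b} = at t"
        using t by (intro at_within_interior) (simp add: interior_atLeastAtMost_real)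
      then show ?thesis
        using analytic_curve_has_vector_derivative[OF \<open>a < b\<close> an t'] by (simp add: d_def)
    qed
    have "((\<lambda>u. cnj w * (\<gamma> u - g)) has_vector_derivative cnj w * (d - 0)) (at t)"
      by (intro has_vector_derivative_mult_right has_vector_derivative_diff der has_vector_derivative_const)
    then have "((\<lambda>u. Im (cnj w * (\<gamma> u - g))) has_vector_derivative Im (cnj w * (d - 0))) (at t)"
      by (rule bounded_linear.has_vector_derivative[OF bounded_linear_Im])
    then have "((\<lambda>u. Im (cnj w * (\<gamma> u - g))) has_real_derivative Im (cnj w * (d - 0))) (at t)"
      by (simp only: has_real_derivative_iff_has_vector_derivative)
    then have "(\<alpha>s has_real_derivative - Im (cnj w * (d - 0)) / W) (at t)"
      unfolding \<alpha>s_def by (intro DERIV_cdivide DERIV_minus)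
    also have "- Im (cnj w * (d - 0)) / W = 1"
      using \<open>W \<noteq> 0\<close> by (simp add: W_def field_simps)
    finally have \<alpha>_der: "(\<alpha>s has_real_derivative 1) (at t)" .
    have \<alpha>t: "\<alpha>s t = 0" "\<beta> t = 0"
      by (simp_all add: \<alpha>s_def \<beta>_def g_def h_def height_def)
    have "isCont (\<lambda>u. \<alpha>s u / s + \<beta> u) t"
      using has_vector_derivative_continuous[OF der] \<open>s \<noteq> 0\<close> \<open>W \<noteq> 0\<close>
      unfolding \<alpha>s_def \<beta>_def h_def height_def by (intro continuous_intros) auto
    then have "\<forall>\<^sub>F u in at t. \<alpha>s u / s + \<beta> u < 1"
      unfolding isCont_def by (rule order_tendstoD) (simp add: \<alpha>t)
    then obtain e1 where "0 < e1" and e1: "\<And>u. u \<noteq> t \<Longrightarrow> dist u t < e1 \<Longrightarrow> \<alpha>s u / s + \<beta> u < 1"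
      unfolding eventually_at by blast
    show ?thesis
    proof (cases "0 < s")
      case True
      obtain e2 where "0 < e2" and e2: "\<And>k. 0 < k \<Longrightarrow> k < e2 \<Longrightarrow> \<alpha>s t < \<alpha>s (t + k)"
        using DERIV_pos_inc_right[OF \<alpha>_der] by auto
      define e where "e = min (min e1 e2) (b - t)"
      have "0 < e"
        using \<open>0 < e1\<close> \<open>0 < e2\<close> t by (simp add: e_def)
      have e: "e \<le> e1" "e \<le> e2" "e \<le> b - t"
        by (simp_all add: e_def)
      have "{t<..<t + e} \<subseteq> E"
      proof
        fix u
        assume u: "u \<in> {t<..<t + e}"
        then have "0 < \<alpha>s u"
          using e2[of "u - t"] \<alpha>t e by simp
        moreover have "\<alpha>s u / s + \<beta> u < 1"
          using u e by (intro e1) (simp_all add: dist_real_def)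
        ultimately show "u \<in> E"
          using u t e True by (simp add: E_def)
      qed
      then show ?thesis
        by (rule infinite_super) (use \<open>0 < e\<close> in simp)
    next
      case False
      obtain e2 where "0 < e2" and e2: "\<And>k. 0 < k \<Longrightarrow> k < e2 \<Longrightarrow> \<alpha>s (t - k) < \<alpha>s t"
        using DERIV_pos_inc_left[OF \<alpha>_der] by auto
      define e where "e = min (min e1 e2) (t - a)"
      have "0 < e"
        using \<open>0 < e1\<close> \<open>0 < e2\<close> t by (simp add: e_def)
      have e: "e \<le> e1" "e \<le> e2" "e \<le> t - a"
        by (simp_all add: e_def)
      have "{t - e<..<t} \<subseteq> E"
      proof
        fix u
        assume u: "u \<in> {t - e<..<t}"
        then have "\<alpha>s u < 0"
          using e2[of "t - u"] \<alpha>t e by simp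
        moreover have "\<alpha>s u / s + \<beta> u < 1"
          using u e by (intro e1) (simp_all add: dist_real_def)
        ultimately show "u \<in> E"
          using u t e False \<open>s \<noteq> 0\<close> by (simp add: E_def zero_less_divide_iff)
      qed
      then show ?thesis
        by (rule infinite_super) (use \<open>0 < e\<close> in simp)
    qed
  qed
  moreover have "E \<subseteq> {t \<in> {a..b}. height d g (\<gamma> t) = 0}"
    using on_tangent by (auto simp: E_def h_def)
  ultimately have "h (\<gamma> u) = 0" if "u \<in> {a..b}" for u
    unfolding h_def by (rule analytic_curve_in_line[OF \<open>a < b\<close> an _ _ that])
  then show False
    using not_line by blast
qed


subsection \<open>The operator of a tangent line\<close>

text \<open>For an adjoint \<open>B\<close> of \<open>A\<close> this is the imaginary part of \<open>cnj d * (A - g)\<close>.\<close>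

definition tangent_operator ::
    "('a \<Rightarrow> 'a) \<Rightarrow> ('a \<Rightarrow> 'a) \<Rightarrow> complex \<Rightarrow> complex \<Rightarrow> 'a \<Rightarrow> 'a::complex_inner"
  where "tangent_operator A B d g x = (cnj d / (2 * \<i>)) *\<^sub>C A x + ((- d / (2 * \<i>)) *\<^sub>C B x +
    ((d * cnj g - cnj d * g) / (2 * \<i>)) *\<^sub>C x)"

lemma cinner_adjoint_left:
  assumes "\<And>x y. cinner (A x) y = cinner x (B y)"
  shows "cinner (B x) y = cinner x (A y)"
  by (metis assms cinner_commute)

lemma bounded_clinear_tangent_operator:
  assumes A: "bounded_clinear A" and B: "bounded_clinear B"
  shows "bounded_clinear (tangent_operator A B d g)"
  unfolding bounded_clinear_def tangent_operator_def[abs_def]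
proof (intro conjI allI)
  have cont: "bounded_linear (\<lambda>x. c *\<^sub>C h x)" if "bounded_linear h" for c and h :: "'a \<Rightarrow> 'a"
    by (rule bounded_linear_compose[OF bounded_bilinear.bounded_linear_right[OF bounded_bilinear_scaleC] that])
  show "bounded_linear (\<lambda>x. (cnj d / (2 * \<i>)) *\<^sub>C A x + ((- d / (2 * \<i>)) *\<^sub>C B x +
      ((d * cnj g - cnj d * g) / (2 * \<i>)) *\<^sub>C x))"
    by (intro bounded_linear_add cont bounded_linear_ident
        bounded_clinear_bounded_linear[OF A] bounded_clinear_bounded_linear[OF B])
qed (simp add: bounded_clinear_scaleC[OF A] bounded_clinear_scaleC[OF B] scaleC_add_right scaleC_scaleC
    mult.commute)

lemma tangent_operator_symmetric:
  assumes adj: "\<And>x y. cinner (A x) y = cinner x (B y)"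
  shows "cinner (tangent_operator A B d g x) y = cinner x (tangent_operator A B d g y)"
  unfolding tangent_operator_def cinner_add_left cinner_add_right cinner_scaleC_left cinner_scaleC_right
    adj cinner_adjoint_left[of A B, OF adj]
  by (simp add: field_simps)

lemma Re_cinner_tangent_operator:
  assumes adj: "\<And>x y. cinner (A x) y = cinner x (B y)"
  shows "Re (cinner (tangent_operator A B d g x) x) = Im (cnj d * (cinner (A x) x - g * cinner x x))"
proof -
  define c where "c = cnj d * (cinner (A x) x - g * cinner x x)"
  have "cinner (B x) x = cnj (cinner (A x) x)"
    by (metis adj cinner_commute)
  moreover have "cnj (cinner x x) = cinner x x"
    by (metis cinner_commute)
  ultimately have "cinner (tangent_operator A B d g x) x = (c - cnj c) / (2 * \<i>)"
    unfolding tangent_operator_def cinner_add_left cinner_scaleC_left c_def by (simp add: field_simps)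
  also have "\<dots> = of_real (Im c)"
    unfolding complex_diff_cnj by (intro complex_eqI) simp_all
  finally show ?thesis
    by (simp add: c_def)
qed

lemma Re_cinner_tangent_operator_unit:
  assumes adj: "\<And>x y. cinner (A x) y = cinner x (B y)" and "norm x = 1"
  shows "Re (cinner (tangent_operator A B d g x) x) = height d g (cinner (A x) x)"
  using assms(2) by (simp add: Re_cinner_tangent_operator[of A B, OF adj] height_def cinner_self)

lemma Re_cinner_tangent_operator_scaled:
  assumes A: "bounded_clinear A" and adj: "\<And>x y. cinner (A x) y = cinner x (B y)" and "x \<noteq> 0"
  obtains u where "norm u = 1"
    and "Re (cinner (tangent_operator A B d g x) x) = (norm x)\<^sup>2 * height d g (cinner (A u) u)"
proof -
  define u where "u = (1 / norm x) *\<^sub>R x"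
  have "norm u = 1"
    using \<open>x \<noteq> 0\<close> by (simp add: u_def)
  have x: "of_real (norm x) *\<^sub>C u = x"
    using \<open>x \<noteq> 0\<close> by (simp add: u_def scaleR_scaleC[symmetric])
  have "cinner u u = 1"
    by (simp add: cinner_self \<open>norm u = 1\<close>)
  then have "cinner (A (of_real k *\<^sub>C u)) (of_real k *\<^sub>C u) - g * cinner (of_real k *\<^sub>C u) (of_real k *\<^sub>C u) =
      of_real (k\<^sup>2) * (cinner (A u) u - g)" for k
    by (simp add: bounded_clinear_scaleC[OF A] cinner_scaleC_left cinner_scaleC_right
        power2_eq_square algebra_simps)
  from this[of "norm x", unfolded x] have "Re (cinner (tangent_operator A B d g x) x) =
      Im (of_real ((norm x)\<^sup>2) * (cnj d * (cinner (A u) u - g)))"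
    by (simp only: Re_cinner_tangent_operator[of A B, OF adj] mult.left_commute)
  also have "\<dots> = (norm x)\<^sup>2 * height d g (cinner (A u) u)"
    by (simp only: height_def Im_complex_of_real Re_complex_of_real times_complex.sel mult_zero_left add_0_right)
  finally show ?thesis
    using \<open>norm u = 1\<close> that by blast
qed

lemma tangent_operator_nonneg:
  assumes A: "bounded_clinear A" and adj: "\<And>x y. cinner (A x) y = cinner x (B y)"
    and nonneg: "\<And>z. z \<in> numerical_range A \<Longrightarrow> 0 \<le> height d g z"
  shows "0 \<le> Re (cinner (tangent_operator A B d g x) x)"
proof (cases "x = 0")
  case False
  obtain u where u: "norm u = 1"
    "Re (cinner (tangent_operator A B d g x) x) = (norm x)\<^sup>2 * height d g (cinner (A u) u)"
    by (rule Re_cinner_tangent_operator_scaled[of A B x, OF A adj False])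
  have "0 \<le> height d g (cinner (A u) u)"
    using u(1) by (intro nonneg) (auto simp: numerical_range_def)
  then show ?thesis
    unfolding u(2) by simp
qed (simp add: cinner_zero_right)

text \<open>Only real factors come out, since \<open>d\<close> enters together with its conjugate.
  This moves the orienting factor of the tangent out of the operator.\<close>

lemma tangent_operator_of_real_mult:
  "tangent_operator A B (of_real r * d) g x = of_real r *\<^sub>C tangent_operator A B d g x"
  by (simp add: tangent_operator_def scaleC_add_right scaleC_scaleC right_diff_distrib mult.assoc
      mult.left_commute[of \<i>])

lemma tangent_operator_coercive:
  assumes A: "bounded_clinear A" and B: "bounded_clinear B"
    and adj: "\<And>x y. cinner (A x) y = cinner x (B y)"
    and nonneg: "\<And>z. z \<in> numerical_range A \<Longrightarrow> 0 \<le> height d g z"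
    and ess: "\<And>z. z \<in> essential_numerical_range A \<Longrightarrow> height d g z \<noteq> 0"
  shows "\<exists>(n::nat) f \<delta>. orthonormal_on f {..<n} \<and> 0 < \<delta> \<and> (\<forall>x. \<delta> * (norm x)\<^sup>2 \<le>
    Re (cinner (tangent_operator A B d g x) x) + (norm (projection_onto f {..<n} x))\<^sup>2)"
proof -
  have cont: "continuous_on UNIV (height d g)"
    unfolding height_def by (intro continuous_intros)
  obtain n :: nat and f e where f: "orthonormal_on f {..<n}" and "0 < e"
    and gap: "\<forall>x. norm x = 1 \<longrightarrow> (\<forall>i<n. cinner x (f i) = 0) \<longrightarrow> e \<le> height d g (cinner (A x) x)"
    using essential_numerical_range_gap[OF A cont nonneg ess] by blast
  have "e \<le> Re (cinner (tangent_operator A B d g x) x)"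
    if "norm x = 1" "\<forall>i\<in>{..<n}. cinner x (f i) = 0" for x
    unfolding Re_cinner_tangent_operator_unit[of A B, OF adj that(1)] using gap that by simp
  from coercive_add_projection[OF bounded_clinear_tangent_operator[OF A B]
      tangent_operator_nonneg[of A B, OF A adj nonneg] finite_lessThan f \<open>0 < e\<close> this]
  show ?thesis
    using f by blast
qed

text \<open>Unit vectors whose quadratic values tend to \<open>g\<close> make the form of the
  tangent operator tend to zero, hence have a norm convergent subsequence. Norm convergence keeps
  the limit a unit vector and passes to the limit in the quadratic values of
  \<open>A\<close>.\<close>

lemma contact_point_attained:
  fixes A :: "'a::chilbert_space \<Rightarrow> 'a"
  assumes A: "bounded_clinear A"
    and nonneg: "\<And>z. z \<in> numerical_range A \<Longrightarrow> 0 \<le> height d g z"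
    and ess: "\<And>z. z \<in> essential_numerical_range A \<Longrightarrow> height d g z \<noteq> 0"
    and g: "g \<in> closure (numerical_range A)"
  shows "g \<in> numerical_range A"
proof -
  obtain B where B: "bounded_clinear B" and adj: "\<And>x y. cinner (A x) y = cinner x (B y)"
    using adjoint_exists[OF A] by blast
  obtain n :: nat and f \<delta> where "orthonormal_on f {..<n}" and "0 < \<delta>"
    and "\<forall>x. \<delta> * (norm x)\<^sup>2 \<le>
      Re (cinner (tangent_operator A B d g x) x) + (norm (projection_onto f {..<n} x))\<^sup>2"
    using tangent_operator_coercive[of A B d g, OF A B adj nonneg ess] by blast
  then have coercive: "\<delta> * (norm x)\<^sup>2 \<le>
      Re (cinner (tangent_operator A B d g x) x) + (norm (projection_onto f {..<n} x))\<^sup>2" for x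
    by blast
  obtain w where w: "\<And>k. w k \<in> numerical_range A" "w \<longlonglongrightarrow> g"
    using g unfolding closure_sequential by blast
  have "\<exists>x. norm x = 1 \<and> w k = cinner (A x) x" for k
    using w(1)[of k] by (auto simp: numerical_range_def)
  then obtain x where x: "\<And>k. norm (x k) = 1" "\<And>k. w k = cinner (A (x k)) (x k)"
    by metis
  have "(\<lambda>k. height d g (w k)) \<longlonglongrightarrow> height d g g"
    unfolding height_def by (intro tendsto_intros w)
  moreover have "height d g g = 0"
    by (simp add: height_def)
  ultimately have lim: "(\<lambda>k. Re (cinner (tangent_operator A B d g (x k)) (x k))) \<longlonglongrightarrow> 0"
    by (simp only: Re_cinner_tangent_operator_unit[of A B, OF adj x(1)] x(2))
  obtain r y where r: "strict_mono (r :: nat \<Rightarrow> nat)" and y: "(x \<circ> r) \<longlonglongrightarrow> y"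
    by (rule minimising_subsequence_convergent[OF bounded_clinear_tangent_operator[OF A B]
        tangent_operator_nonneg[of A B, OF A adj nonneg] \<open>0 < \<delta>\<close> coercive x(1) lim])
  have "(\<lambda>k. norm ((x \<circ> r) k)) \<longlonglongrightarrow> norm y"
    by (intro tendsto_norm y)
  then have "norm y = 1"
    by (simp add: x(1) LIMSEQ_const_iff)
  have "(\<lambda>k. cinner (A ((x \<circ> r) k)) ((x \<circ> r) k)) \<longlonglongrightarrow> cinner (A y) y"
    by (intro tendsto_cinner bounded_linear.tendsto[OF bounded_clinear_bounded_linear[OF A]] y)
  moreover have "(\<lambda>k. cinner (A ((x \<circ> r) k)) ((x \<circ> r) k)) \<longlonglongrightarrow> g"
    using LIMSEQ_subseq_LIMSEQ[OF w(2) r] by (simp add: comp_def x(2))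
  ultimately have "g = cinner (A y) y"
    by (rule LIMSEQ_unique[rotated])
  then show ?thesis
    using \<open>norm y = 1\<close> by (auto simp: numerical_range_def)
qed

subsection \<open>Analytic continuation of kernels\<close>

text \<open>Coercivity is an open condition: the operator norm of \<open>Q z - Q z0\<close> is at
  most the weighted sum of coefficient changes, and half of \<open>d\<close> pays for it.\<close>

lemma coercive_perturbation:
  fixes Q :: "complex \<Rightarrow> 'a::complex_inner \<Rightarrow> 'a"
  assumes "finite I" and B: "\<And>i. i \<in> I \<Longrightarrow> bounded_clinear (B i)"
    and \<alpha>: "\<And>i. i \<in> I \<Longrightarrow> isCont (\<alpha> i) z0"
    and Q: "\<And>z x. Q z x = (\<Sum>i\<in>I. \<alpha> i z *\<^sub>C B i x)"
    and "0 < d" and coercive: "\<And>x. d * (norm x)\<^sup>2 \<le> Re (cinner (Q z0 x) x)"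
  shows "\<exists>e>0. \<forall>z\<in>ball z0 e. \<forall>x. d / 2 * (norm x)\<^sup>2 \<le> Re (cinner (Q z x) x)"
proof -
  have "\<forall>i\<in>I. \<exists>K. \<forall>x. norm (B i x) \<le> norm x * K"
    using bounded_linear.bounded[OF bounded_clinear_bounded_linear[OF B]] by blast
  then obtain K where K: "\<And>i x. i \<in> I \<Longrightarrow> norm (B i x) \<le> norm x * K i"
    by metis
  have "((\<lambda>z. \<Sum>i\<in>I. norm (\<alpha> i z - \<alpha> i z0) * K i) \<longlongrightarrow> (\<Sum>i\<in>I. norm (\<alpha> i z0 - \<alpha> i z0) * K i)) (at z0)"
    using \<alpha> unfolding isCont_def by (intro tendsto_intros) auto
  then have "\<forall>\<^sub>F z in at z0. (\<Sum>i\<in>I. norm (\<alpha> i z - \<alpha> i z0) * K i) < d / 2"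
    using \<open>0 < d\<close> by (intro order_tendstoD) auto
  then obtain e where "0 < e"
    and e: "\<And>z. z \<noteq> z0 \<Longrightarrow> dist z z0 < e \<Longrightarrow> (\<Sum>i\<in>I. norm (\<alpha> i z - \<alpha> i z0) * K i) < d / 2"
    unfolding eventually_at by blast
  have "d / 2 * (norm x)\<^sup>2 \<le> Re (cinner (Q z x) x)" if z: "z \<in> ball z0 e" for z x
  proof -
    have small: "(\<Sum>i\<in>I. norm (\<alpha> i z - \<alpha> i z0) * K i) \<le> d / 2"
      using e[of z] z \<open>0 < d\<close> by (cases "z = z0") (simp_all add: dist_commute less_imp_le)
    have "Q z0 x - Q z x = (\<Sum>i\<in>I. (\<alpha> i z0 - \<alpha> i z) *\<^sub>C B i x)"
      by (simp only: Q scaleC_diff_left sum_subtractf)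
    then have "norm (Q z0 x - Q z x) \<le> (\<Sum>i\<in>I. norm ((\<alpha> i z0 - \<alpha> i z) *\<^sub>C B i x))"
      by (simp only: norm_sum)
    also have "\<dots> \<le> (\<Sum>i\<in>I. norm (\<alpha> i z - \<alpha> i z0) * K i * norm x)"
    proof (intro sum_mono)
      fix i
      assume "i \<in> I"
      then have "norm (\<alpha> i z - \<alpha> i z0) * norm (B i x) \<le> norm (\<alpha> i z - \<alpha> i z0) * (norm x * K i)"
        by (intro mult_left_mono K) auto
      then show "norm ((\<alpha> i z0 - \<alpha> i z) *\<^sub>C B i x) \<le> norm (\<alpha> i z - \<alpha> i z0) * K i * norm x"
        by (simp add: norm_scaleC norm_minus_commute[of "\<alpha> i z0"] mult_ac)
    qed
    also have "\<dots> = (\<Sum>i\<in>I. norm (\<alpha> i z - \<alpha> i z0) * K i) * norm x"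
      by (simp only: sum_distrib_right)
    also have "\<dots> \<le> d / 2 * norm x"
      using small by (rule mult_right_mono) simp
    finally have "norm (Q z0 x - Q z x) * norm x \<le> d / 2 * norm x * norm x"
      by (rule mult_right_mono) simp
    moreover have "Re (cinner (Q z0 x) x) - Re (cinner (Q z x) x) \<le> norm (Q z0 x - Q z x) * norm x"
      using complex_Re_le_cmod[of "cinner (Q z0 x - Q z x) x"] cinner_Cauchy_Schwarz[of "Q z0 x - Q z x" x]
      by (simp add: cinner_diff_left)
    moreover have "d * (norm x)\<^sup>2 - d / 2 * norm x * norm x = d / 2 * (norm x)\<^sup>2"
      by (simp add: power2_eq_square field_simps)
    ultimately show ?thesis
      using coercive[of x] by linarith
  qed
  with \<open>0 < e\<close> show ?thesis
    by blast
qed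

text \<open>This is the analytic Fredholm alternative for \<open>Q z\<close> minus the projection:
  accumulation of singular parameters rules out the discrete case. The conclusion includes nonreal
  \<open>z\<close>, so solvability rests on coercivity of \<open>Q z\<close>.\<close>

lemma kernel_propagates:
  fixes Q :: "complex \<Rightarrow> 'a::chilbert_space \<Rightarrow> 'a" and f :: "nat \<Rightarrow> 'a"
  assumes "finite I" and "0 < r" and B: "\<And>i. i \<in> I \<Longrightarrow> bounded_clinear (B i)"
    and \<alpha>: "\<And>i. i \<in> I \<Longrightarrow> \<alpha> i holomorphic_on ball (of_real t0) r"
    and Q: "\<And>z x. Q z x = (\<Sum>i\<in>I. \<alpha> i z *\<^sub>C B i x)"
    and "0 < d" and coercive: "\<And>x. d * (norm x)\<^sup>2 \<le> Re (cinner (Q (of_real t0) x) x)"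
    and limpt: "t0 islimpt S"
    and kernel: "\<And>t. t \<in> S \<Longrightarrow> \<bar>t - t0\<bar> < r \<Longrightarrow>
      \<exists>x. x \<noteq> 0 \<and> Q (of_real t) x = projection_onto f {..<n} x"
  shows "\<exists>e>0. e \<le> r \<and> (\<forall>z\<in>ball (of_real t0) e. \<exists>x. x \<noteq> 0 \<and> Q z x = projection_onto f {..<n} x)"
proof -
  have cont: "isCont (\<alpha> i) (of_real t0)" if "i \<in> I" for i
    using holomorphic_on_imp_continuous_on[OF \<alpha>[OF that]] \<open>0 < r\<close>
    by (simp add: continuous_on_eq_continuous_at)
  obtain e0 where "0 < e0"
    and e0: "\<forall>z\<in>ball (of_real t0) e0. \<forall>x. d / 2 * (norm x)\<^sup>2 \<le> Re (cinner (Q z x) x)"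
    using coercive_perturbation[where Q = Q and ?z0.0 = "of_real t0", OF \<open>finite I\<close> B cont Q \<open>0 < d\<close> coercive] by blast
  define e where "e = min e0 r"
  define U where "U = ball (complex_of_real t0) e"
  have "0 < e" "e \<le> r"
    using \<open>0 < e0\<close> \<open>0 < r\<close> by (simp_all add: e_def)
  have "0 < d / 2"
    using \<open>0 < d\<close> by simp
  have coer: "d / 2 * (norm x)\<^sup>2 \<le> Re (cinner (Q z x) x)" if "z \<in> U" for z x
    using e0 that by (simp add: U_def e_def)
  have Q_lin: "bounded_clinear (Q z)" for z
    using bounded_clinear_sum[of I B "\<lambda>i. \<alpha> i z", OF B] by (simp add: Q[abs_def])
  have "\<exists>x. Q z x = y" if "z \<in> U" for z y
    by (rule Lax_Milgram_surj[OF Q_lin \<open>0 < d / 2\<close> coer[OF that]])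
  then obtain R where R: "\<And>z y. z \<in> U \<Longrightarrow> Q z (R z y) = y"
    by metis
  define F where "F z = Determinant.det
    (mat n n (\<lambda>(i, j). (if i = j then 1 else 0) - cinner (R z (f j)) (f i)))" for z
  have iff: "(\<exists>x. x \<noteq> 0 \<and> Q z x = projection_onto f {..<n} x) \<longleftrightarrow> F z = 0" if "z \<in> U" for z
    unfolding F_def
    by (rule kernel_iff_det_zero[OF Q_lin coercive_injective[OF Q_lin \<open>0 < d / 2\<close> coer[OF that]] R[OF that]])
  have "F holomorphic_on U"
    unfolding F_def
  proof (intro holomorphic_on_det holomorphic_on_diff holomorphic_on_const)
    show "(\<lambda>z. cinner (R z (f j)) (f i)) holomorphic_on U" for i j
    proof (rule holomorphic_inverse_family[OF \<open>finite I\<close> _ B _ Q \<open>0 < d / 2\<close> coer R])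
      show "\<alpha> i holomorphic_on U" if "i \<in> I" for i
        using \<alpha>[OF that] by (rule holomorphic_on_subset) (auto simp: U_def e_def)
    qed (auto simp: U_def)
  qed
  then have "F z = 0" if "z \<in> U" for z
  proof (rule holomorphic_eq_zero_of_real_limpt[OF _ \<open>0 < e\<close> limpt, of F, folded U_def])
    show "F (of_real t) = 0" if t: "t \<in> S" "\<bar>t - t0\<bar> < e" for t
    proof -
      have "of_real t \<in> U"
        using t(2) by (simp add: U_def dist_of_real dist_real_def abs_minus_commute)
      then show ?thesis
        using iff kernel[OF t(1)] t(2) \<open>e \<le> r\<close> by simp
    qed
  qed (rule that)
  then show ?thesis
    using \<open>0 < e\<close> \<open>e \<le> r\<close> iff unfolding U_def by blast
qed


subsection \<open>Contact parameters\<close>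

lemma height_of_real_mult: "height (of_real r * d) g z = r * height d g z"
  by (simp add: height_def mult.assoc)

text \<open>One negative height forces all heights to be nonpositive, by the sign comparison, and
  the factor \<open>- 1\<close> reverses them.\<close>

lemma tangent_orientation:
  assumes "convex D" and curve: "compact_regular_analytic_curve \<gamma> a b" "\<gamma> ` {a..b} \<subseteq> frontier D"
    and t: "t \<in> {a..b}"
  shows "\<exists>\<sigma>::real. \<sigma> \<noteq> 0 \<and> (\<forall>z\<in>closure D. 0 \<le> height (of_real \<sigma> * velocity \<gamma> a b t) (\<gamma> t) z)"
proof (cases "\<exists>z\<in>closure D. height (velocity \<gamma> a b t) (\<gamma> t) z < 0")
  case True
  then obtain z where z: "z \<in> closure D" "height (velocity \<gamma> a b t) (\<gamma> t) z < 0"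
    by blast
  have "0 \<le> height (of_real (- 1) * velocity \<gamma> a b t) (\<gamma> t) w" if "w \<in> closure D" for w
    using tangent_supports[OF assms z(1) that] z(2)
    by (simp only: height_of_real_mult) (simp add: zero_le_mult_iff)
  then show ?thesis
    by (intro exI[of _ "- 1"]) auto
next
  case False
  then show ?thesis
    by (intro exI[of _ 1]) (auto simp: not_less)
qed

text \<open>\<open>t0\<close> may be an endpoint, since the coercive family and the expansion of the
  curve exist there too. The passage from a kernel vector back to a contact point is what asks for
  an interior parameter.\<close>

lemma attained_near_limit:
  fixes A :: "'a::chilbert_space \<Rightarrow> 'a"
  assumes A: "bounded_clinear A" and "convex D" and W: "numerical_range A \<subseteq> closure D"
    and curve: "compact_regular_analytic_curve \<gamma> a b" "\<gamma> ` {a..b} \<subseteq> frontier D"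
    and ess: "\<And>t. t \<in> {a..b} \<Longrightarrow> tangent_line \<gamma> {a..b} t \<inter> essential_numerical_range A = {}"
    and not_segment: "\<not> (\<exists>p q. \<gamma> ` {a..b} = closed_segment p q)"
    and t0: "t0 \<in> {a..b}" "t0 islimpt {t \<in> {a..b}. \<gamma> t \<in> numerical_range A}"
  shows "\<exists>e>0. \<forall>t\<in>{a<..<b}. \<bar>t - t0\<bar> < e \<longrightarrow> \<gamma> t \<in> numerical_range A"
proof -
  have "a < b" and an: "real_analytic_on \<gamma> {a..b}"
    and reg: "\<And>t. t \<in> {a..b} \<Longrightarrow> velocity \<gamma> a b t \<noteq> 0"
    using curve(1) by (auto simp: compact_regular_analytic_curve_def)
  obtain B where B: "bounded_clinear B" and adj: "\<And>x y. cinner (A x) y = cinner x (B y)"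
    using adjoint_exists[OF A] by blast
  define S where "S t = tangent_operator A B (velocity \<gamma> a b t) (\<gamma> t)" for t
  obtain \<sigma> :: real where "\<sigma> \<noteq> 0"
    and \<sigma>: "\<forall>z\<in>closure D. 0 \<le> height (of_real \<sigma> * velocity \<gamma> a b t0) (\<gamma> t0) z"
    using tangent_orientation[OF \<open>convex D\<close> curve t0(1)] by blast
  have "height (of_real \<sigma> * velocity \<gamma> a b t0) (\<gamma> t0) z \<noteq> 0" if "z \<in> essential_numerical_range A" for z
    using ess[OF t0(1)] that \<open>\<sigma> \<noteq> 0\<close> height_eq_0_iff[OF reg[OF t0(1)], of "\<gamma> t0" z]
    unfolding height_of_real_mult tangent_line_def by auto
  from tangent_operator_coercive[of A B "of_real \<sigma> * velocity \<gamma> a b t0" "\<gamma> t0", OF A B adj _ this]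
  obtain n :: nat and f \<delta> where f: "orthonormal_on f {..<n}" and "0 < \<delta>"
    and coercive: "\<forall>x. \<delta> * (norm x)\<^sup>2 \<le> Re (cinner (of_real \<sigma> *\<^sub>C S t0 x) x) +
      (norm (projection_onto f {..<n} x))\<^sup>2"
    using \<sigma> W unfolding tangent_operator_of_real_mult S_def by blast
  obtain r G Gs where "0 < r" and hol: "G holomorphic_on ball (of_real t0) r"
      "Gs holomorphic_on ball (of_real t0) r"
    and G: "\<And>t. t \<in> {a..b} \<Longrightarrow> \<bar>t - t0\<bar> < r \<Longrightarrow> G (of_real t) = \<gamma> t"
      "\<And>t. t \<in> {a..b} \<Longrightarrow> \<bar>t - t0\<bar> < r \<Longrightarrow> Gs (of_real t) = cnj (\<gamma> t)"
      "\<And>t. t \<in> {a..b} \<Longrightarrow> \<bar>t - t0\<bar> < r \<Longrightarrow> deriv G (of_real t) = velocity \<gamma> a b t"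
      "\<And>t. t \<in> {a..b} \<Longrightarrow> \<bar>t - t0\<bar> < r \<Longrightarrow> deriv Gs (of_real t) = cnj (velocity \<gamma> a b t)"
    by (rule analytic_curve_extension[OF \<open>a < b\<close> an t0(1)]) blast
  \<comment> \<open>Indices 0, 1 and 2 carry the coefficients of \<open>tangent_operator\<close>,
    times \<sigma>, with the conjugated curve and velocity replaced by \<open>Gs\<close> and
    \<open>deriv Gs\<close>; the remaining index carries the projection.\<close>
  define \<alpha> where "\<alpha> i z = (if i = 0 then of_real \<sigma> * (deriv Gs z / (2 * \<i>))
    else if i = 1 then of_real \<sigma> * (- deriv G z / (2 * \<i>))
    else if i = 2 then of_real \<sigma> * ((deriv G z * Gs z - deriv Gs z * G z) / (2 * \<i>))
    else 1)" for i :: nat and z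
  define Bs where "Bs i = (if i = 0 then A else if i = 1 then B else if i = 2 then (\<lambda>x. x)
    else projection_onto f {..<n})" for i :: nat
  define Q where "Q z x = (\<Sum>i\<in>{..<4}. \<alpha> i z *\<^sub>C Bs i x)" for z x
  have Q_real: "Q (of_real t) x = of_real \<sigma> *\<^sub>C S t x + projection_onto f {..<n} x"
    if t: "t \<in> {a..b}" "\<bar>t - t0\<bar> < r" for t x
  proof -
    have "Q z x = \<alpha> 0 z *\<^sub>C Bs 0 x + (\<alpha> 1 z *\<^sub>C Bs 1 x + (\<alpha> 2 z *\<^sub>C Bs 2 x + \<alpha> 3 z *\<^sub>C Bs 3 x))" for z
      by (simp add: Q_def eval_nat_numeral)
    then show ?thesis
      by (simp only: \<alpha>_def Bs_def S_def tangent_operator_def G[OF t] scaleC_add_right scaleC_scaleC)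
        (simp add: scaleC_one)
  qed
  have "\<exists>e>0. e \<le> r \<and>
      (\<forall>z\<in>ball (complex_of_real t0) e. \<exists>x. x \<noteq> 0 \<and> Q z x = projection_onto f {..<n} x)"
  proof (rule kernel_propagates[where I = "{..<4}" and B = Bs and \<alpha> = \<alpha> and d = \<delta>])
    show "bounded_clinear (Bs i)" for i
      using A B bounded_clinear_projection unfolding Bs_def
      by (auto simp: bounded_clinear_def bounded_linear_ident)
    have "deriv G holomorphic_on ball (of_real t0) r" "deriv Gs holomorphic_on ball (of_real t0) r"
      by (intro holomorphic_deriv hol open_ball)+
    then show "\<alpha> i holomorphic_on ball (of_real t0) r" for i
      unfolding \<alpha>_def by (cases "i = 0"; cases "i = 1"; cases "i = 2") (auto intro!: holomorphic_intros hol)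
    show "Q z x = (\<Sum>i\<in>{..<4}. \<alpha> i z *\<^sub>C Bs i x)" for z x
      by (rule Q_def)
    show "\<delta> * (norm x)\<^sup>2 \<le> Re (cinner (Q (of_real t0) x) x)" for x
    proof -
      have "Re (cinner (projection_onto f {..<n} x) x) = (norm (projection_onto f {..<n} x))\<^sup>2"
        unfolding cinner_projection_self norm_projection_sq[OF finite_lessThan f] by (rule Re_complex_of_real)
      then show ?thesis
        using coercive Q_real[OF t0(1)] \<open>0 < r\<close> by (simp add: cinner_add_left)
    qed
    show "t0 islimpt {t \<in> {a..b}. \<gamma> t \<in> numerical_range A}"
      by (rule t0(2))
    fix t
    assume t: "t \<in> {t \<in> {a..b}. \<gamma> t \<in> numerical_range A}" "\<bar>t - t0\<bar> < r"
    then have tab: "t \<in> {a..b}"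
      by simp
    obtain x where x: "norm x = 1" "\<gamma> t = cinner (A x) x"
      using t(1) by (auto simp: numerical_range_def)
    \<comment> \<open>The orientation at \<open>t\<close> is chosen independently of \<sigma>. It
      only serves to reach \<open>S t x = 0\<close>, from which the factor has disappeared.\<close>
    obtain \<tau> :: real where "\<tau> \<noteq> 0"
      and \<tau>: "\<forall>z\<in>closure D. 0 \<le> height (of_real \<tau> * velocity \<gamma> a b t) (\<gamma> t) z"
      using tangent_orientation[OF \<open>convex D\<close> curve tab] by blast
    have "tangent_operator A B (of_real \<tau> * velocity \<gamma> a b t) (\<gamma> t) x = 0"
    proof (rule semidefinite_kernel[OF bounded_clinear_tangent_operator[OF A B]])
      show "cinner (tangent_operator A B d g u) v = cinner u (tangent_operator A B d g v)" for d g u v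
        by (rule tangent_operator_symmetric[OF adj])
      show "0 \<le> Re (cinner (tangent_operator A B (of_real \<tau> * velocity \<gamma> a b t) (\<gamma> t) u) u)" for u
        using \<tau> W by (intro tangent_operator_nonneg[of A B, OF A adj]) auto
      show "Re (cinner (tangent_operator A B (of_real \<tau> * velocity \<gamma> a b t) (\<gamma> t) x) x) = 0"
        unfolding Re_cinner_tangent_operator_unit[of A B, OF adj x(1)] x(2)[symmetric]
        by (simp add: height_def)
    qed
    then have "(1 / of_real \<tau>) *\<^sub>C (of_real \<tau> *\<^sub>C S t x) = 0"
      by (simp add: tangent_operator_of_real_mult S_def scaleC_zero_right)
    then have "S t x = 0"
      using \<open>\<tau> \<noteq> 0\<close> by (simp add: scaleC_scaleC scaleC_one)
    then show "\<exists>x. x \<noteq> 0 \<and> Q (of_real t) x = projection_onto f {..<n} x"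
      using x(1) Q_real[OF tab t(2)] by (intro exI[of _ x]) (auto simp: scaleC_zero_right)
  qed (use \<open>0 < r\<close> \<open>0 < \<delta>\<close> in auto)
  then obtain e where "0 < e" "e \<le> r"
    and e: "\<forall>z\<in>ball (complex_of_real t0) e. \<exists>x. x \<noteq> 0 \<and> Q z x = projection_onto f {..<n} x"
    by blast
  have "\<gamma> t \<in> numerical_range A" if t: "t \<in> {a<..<b}" "\<bar>t - t0\<bar> < e" for t
  proof -
    have tab: "t \<in> {a..b}"
      using t(1) by simp
    have "of_real t \<in> ball (complex_of_real t0) e"
      using t(2) by (simp add: dist_of_real dist_real_def abs_minus_commute)
    then obtain x where "x \<noteq> 0" "Q (of_real t) x = projection_onto f {..<n} x"
      using e by blast
    then have "of_real \<sigma> *\<^sub>C S t x = 0"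
      using Q_real[OF tab, of x] t(2) \<open>e \<le> r\<close> by simp
    then have "(1 / of_real \<sigma>) *\<^sub>C (of_real \<sigma> *\<^sub>C S t x) = 0"
      by (simp only: scaleC_zero_right)
    then have "S t x = 0"
      using \<open>\<sigma> \<noteq> 0\<close> by (simp add: scaleC_scaleC scaleC_one)
    obtain u where u: "norm u = 1" "Re (cinner (S t x) x) =
        (norm x)\<^sup>2 * height (velocity \<gamma> a b t) (\<gamma> t) (cinner (A u) u)"
      unfolding S_def by (rule Re_cinner_tangent_operator_scaled[of A B x, OF A adj \<open>x \<noteq> 0\<close>])
    have "height (velocity \<gamma> a b t) (\<gamma> t) (cinner (A u) u) = 0"
      using u(2) \<open>S t x = 0\<close> \<open>x \<noteq> 0\<close> by (simp add: cinner_zero_left)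
    moreover have u_in: "cinner (A u) u \<in> numerical_range A"
      using u(1) by (auto simp: numerical_range_def)
    ultimately have "cinner (A u) u = \<gamma> t"
      using W by (intro tangent_meets_only_at_contact[OF \<open>convex D\<close> curve t(1) _ _ not_segment]) auto
    then show ?thesis
      using u_in by simp
  qed
  then show ?thesis
    using \<open>0 < e\<close> by blast
qed

theorem theorem1p3:
  fixes A :: "'a::chilbert_space \<Rightarrow> 'a"
    and D \<Gamma> :: "complex set"
    and \<gamma> :: "real \<Rightarrow> complex"
    and a b :: real
  assumes "bounded_clinear A"
    and "convex D"
    and "numerical_range A \<subseteq> closure D"
    and "compact_regular_analytic_curve \<gamma> a b"
    and "\<Gamma> = \<gamma> ` {a..b}"
    and "\<Gamma> \<subseteq> frontier D"
    and "\<forall>t\<in>{a..b}. tangent_line \<gamma> {a..b} t \<inter> essential_numerical_range A = {}"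
    and "\<not> (\<exists>p q. \<Gamma> = closed_segment p q)"
    and "infinite (closure (numerical_range A) \<inter> \<Gamma>)"
  shows "\<Gamma> \<subseteq> numerical_range A"
proof -
  have "a < b" and an: "real_analytic_on \<gamma> {a..b}"
    and reg: "\<And>t. t \<in> {a..b} \<Longrightarrow> velocity \<gamma> a b t \<noteq> 0"
    using assms(4) by (auto simp: compact_regular_analytic_curve_def)
  have frontier: "\<gamma> ` {a..b} \<subseteq> frontier D"
    and not_segment: "\<not> (\<exists>p q. \<gamma> ` {a..b} = closed_segment p q)"
    using assms(5,6,8) by simp_all
  have attained: "\<gamma> t \<in> numerical_range A"
    if t: "t \<in> {a..b}" and closure: "\<gamma> t \<in> closure (numerical_range A)" for t
  proof -
    obtain \<sigma> :: real where "\<sigma> \<noteq> 0"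
      and \<sigma>: "\<forall>z\<in>closure D. 0 \<le> height (of_real \<sigma> * velocity \<gamma> a b t) (\<gamma> t) z"
      using tangent_orientation[OF assms(2,4) frontier t] by blast
    show ?thesis
    proof (rule contact_point_attained[OF assms(1) _ _ closure])
      show "0 \<le> height (of_real \<sigma> * velocity \<gamma> a b t) (\<gamma> t) z" if "z \<in> numerical_range A" for z
        using that \<sigma> assms(3) by blast
      show "height (of_real \<sigma> * velocity \<gamma> a b t) (\<gamma> t) z \<noteq> 0" if "z \<in> essential_numerical_range A" for z
        using bspec[OF assms(7) t] that \<open>\<sigma> \<noteq> 0\<close> height_eq_0_iff[OF reg[OF t], of "\<gamma> t" z]
        unfolding height_of_real_mult tangent_line_def by auto
    qed
  qed
  define Z where "Z = {t \<in> {a..b}. \<gamma> t \<in> numerical_range A}"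
  have "{a..b} \<subseteq> Z"
  proof (rule infinite_subset_propagates)
    show "Z \<subseteq> {a..b}"
      by (auto simp: Z_def)
    \<comment> \<open>The hypothesis counts points of the plane, the continuation counts parameters:
      finitely many parameters could give only finitely many points.\<close>
    have "closure (numerical_range A) \<inter> \<Gamma> \<subseteq> \<gamma> ` Z"
      using attained by (auto simp: Z_def assms(5))
    then show "infinite Z"
      using assms(9) finite_subset by blast
    fix t0
    assume t0: "t0 \<in> {a..b}" "t0 islimpt Z"
    have "\<exists>e>0. \<forall>t\<in>{a<..<b}. \<bar>t - t0\<bar> < e \<longrightarrow> \<gamma> t \<in> numerical_range A"
      using assms(7) t0(2) unfolding Z_def
      by (intro attained_near_limit[OF assms(1-4) frontier _ not_segment t0(1)]) auto
    then obtain e where "0 < e"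
      and e: "\<And>t. t \<in> {a<..<b} \<Longrightarrow> \<bar>t - t0\<bar> < e \<Longrightarrow> \<gamma> t \<in> numerical_range A"
      by blast
    have cl: "closure {a<..<b} = {a..b}"
      using \<open>a < b\<close> by simp
    have sub: "closure (ball t0 e \<inter> {a<..<b}) \<subseteq> {a..b}"
      unfolding cl[symmetric] by (rule closure_mono) simp
    \<comment> \<open>Interior contacts near \<open>t0\<close> put the curve at a neighbouring
      endpoint into the closure of the range, and \<open>attained\<close> applies at endpoints as
      well.\<close>
    have img: "\<gamma> ` closure (ball t0 e \<inter> {a<..<b}) \<subseteq> closure (numerical_range A)"
    proof (rule image_closure_subset)
      show "continuous_on (closure (ball t0 e \<inter> {a<..<b})) \<gamma>"
        using analytic_curve_continuous[OF \<open>a < b\<close> an] sub by (rule continuous_on_subset)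
      show "\<gamma> ` (ball t0 e \<inter> {a<..<b}) \<subseteq> closure (numerical_range A)"
        using e by (intro image_subsetI subsetD[OF closure_subset]) (simp add: dist_real_def abs_minus_commute)
    qed simp
    have near: "t \<in> closure (ball t0 e \<inter> {a<..<b})" if "t \<in> {a..b}" "\<bar>t - t0\<bar> < e" for t
      using open_Int_closure_subset[OF open_ball, of t0 e "{a<..<b}"] that
      unfolding cl by (auto simp: dist_real_def abs_minus_commute)
    have "t \<in> Z" if "t \<in> {a..b}" "\<bar>t - t0\<bar> < e" for t
      using attained[OF that(1) subsetD[OF img imageI[OF near[OF that]]]] that(1) by (simp add: Z_def)
    then show "\<exists>e>0. \<forall>t\<in>{a..b}. \<bar>t - t0\<bar> < e \<longrightarrow> t \<in> Z"
      using \<open>0 < e\<close> by blast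
  qed
  then show ?thesis
    by (auto simp: Z_def assms(5))
qed

end
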